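(* Let $K$ be an algebraically closed field of characteristic zero, let $k\geq1$, let $V_1,\dots,V_k$ be finite-dimensional $K$-vector spaces, and let $d_1,\dots,d_k$ be positive integers. Let $X=S_{d_1,\dots,d_k}(V_1,\dots,V_k)\subset\mathbb{P}(S^{d_1}V_1\otimes\cdots\otimes S^{d_k}V_k)$ be the Segre-Veronese variety and $\tau(X)$ its tangential variety. Let $[p]\in\tau(X)\setminus X$, and suppose (after reordering the factors) that the factors on which $p$ actually depends are exactly the first $h$ ones, $h\le k$. Then the rank of $p$ with respect to $X$ is $$r_{d_1,\dots,d_k}(p)=\sum_{i=1}^h d_i .$$
   Context: $X=S_{d_1,\dots,d_k}(V_1,\dots,V_k)$ is the image of $\mathbb{P}(V_1)\times\cdots\times\mathbb{P}(V_k)$ under the embedding $\nu_{d_1,\dots,d_k}$ given by the complete linear system $|\mathcal{O}(d_1,\dots,d_k)|$, i.e. the set of classes $[v_1^{\otimes d_1}\otimes\cdots\otimes v_k^{\otimes d_k}]$ with $0\ne v_i\in V_i$. The tangential variety is $\tau(X)=\overline{\bigcup_{[q]\in X}T_{[q]}(X)}$, where $T_{[q]}(X)$ is the projective tangent space. The rank $r_{d_1,\dots,d_k}(p)$ is the minimal $r$ such that $p$ is a linear combination of $r$ tensors of the form $v_1^{\otimes d_1}\otimes\cdots\otimes v_k^{\otimes d_k}$. $p$ does not depend on the $i$-th factor if there is $v_i\in V_i$ such that $p$ is the product of $v_i^{\otimes d_i}$ (in the $i$-th position) with an element of $\bigotimes_{j\neq i}S^{d_j}V_j$; otherwise $p$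 depends on the $i$-th factor. (Thus, when $p$ depends exactly on the first $h$ factors, $p$ is identified with an element of $S^{d_1}V_1\otimes\cdots\otimes S^{d_h}V_h$.) *)

theory Defs
  imports
    "HOL-Library.Poly_Mapping"
    "HOL-Library.FuncSet"
    "HOL-Combinatorics.Permutations"
    "HOL-Computational_Algebra.Computational_Algebra"
begin

section \<open>Symmetric tensors over a family of finite-dimensional spaces\<close>

text \<open>
  The spaces \<open>V i\<close> are finite-dimensional subspaces of one vector space \<open>'v\<close> over the field \<open>'a\<close>
  (scalar multiplication \<open>s\<close>). This is no restriction: any family of vector spaces embeds in its
  direct sum, and the \<open>V i\<close> may overlap arbitrarily.
\<close>

definition fin_dim_subspace :: "('a::field \<Rightarrow> 'v::ab_group_add \<Rightarrow> 'v) \<Rightarrow> 'v set \<Rightarrow> bool" where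
  "fin_dim_subspace s V \<longleftrightarrow>
     module.subspace s V \<and> (\<exists>B. finite B \<and> V = module.span s B)"

text \<open>
  The value outside \<open>V\<close> is fixed to \<open>0\<close>, so that a functional is determined by its values on \<open>V\<close>.
\<close>

definition dual_space :: "('a::field \<Rightarrow> 'v::ab_group_add \<Rightarrow> 'v) \<Rightarrow> 'v set \<Rightarrow> ('v \<Rightarrow> 'a) set" where
  "dual_space s V = {f. (\<forall>x\<in>V. \<forall>y\<in>V. f (x + y) = f x + f y) \<and>
                        (\<forall>c. \<forall>x\<in>V. f (s c x) = c * f x) \<and>
                        (\<forall>x. x \<notin> V \<longrightarrow> f x = 0)}"

text \<open>
  As the \<open>V i\<close> are finite-dimensional, the tensor product of \<open>d i\<close> copies of each \<open>V i\<close>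
  (\<open>i \<in> I\<close>) is the space of multilinear forms on the corresponding product of dual spaces; the pure
  tensor of vectors \<open>x i a\<close> is the form sending \<open>f\<close> to the product of all \<open>f i a (x i a)\<close>.
  An argument of such a form is a family \<open>f\<close> in \<open>arg_space\<close>, where \<open>f i a\<close> is inserted in the
  \<open>a\<close>-th of the \<open>d i\<close> slots belonging to the \<open>i\<close>-th factor.
\<close>

type_synonym ('v, 'a) arg = "nat \<Rightarrow> nat \<Rightarrow> 'v \<Rightarrow> 'a"
type_synonym ('v, 'a) tensor = "('v, 'a) arg \<Rightarrow> 'a"

definition arg_space ::
  "('a::field \<Rightarrow> 'v::ab_group_add \<Rightarrow> 'v) \<Rightarrow> (nat \<Rightarrow> nat) \<Rightarrow> (nat \<Rightarrow> 'v set) \<Rightarrow> nat set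
    \<Rightarrow> ('v, 'a) arg set" where
  "arg_space s d V I = (\<Pi>\<^sub>E i\<in>I. \<Pi>\<^sub>E a\<in>{..<d i}. dual_space s (V i))"

definition upd_slot :: "('v, 'a) arg \<Rightarrow> nat \<Rightarrow> nat \<Rightarrow> ('v \<Rightarrow> 'a) \<Rightarrow> ('v, 'a) arg" where
  "upd_slot f i a g = f(i := (f i)(a := g))"

definition multilinear ::
  "('a::field \<Rightarrow> 'v::ab_group_add \<Rightarrow> 'v) \<Rightarrow> (nat \<Rightarrow> nat) \<Rightarrow> (nat \<Rightarrow> 'v set) \<Rightarrow> nat set
    \<Rightarrow> ('v, 'a) tensor \<Rightarrow> bool" where
  "multilinear s d V I T \<longleftrightarrow>
     (\<forall>f\<in>arg_space s d V I. \<forall>i\<in>I. \<forall>a<d i. \<forall>g\<in>dual_space s (V i). \<forall>h\<in>dual_space s (V i). \<forall>c.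
        T (upd_slot f i a (\<lambda>x. g x + h x)) = T (upd_slot f i a g) + T (upd_slot f i a h) \<and>
        T (upd_slot f i a (\<lambda>x. c * g x)) = c * T (upd_slot f i a g))"

text \<open>
  The tensor product of the symmetric powers \<open>S\<^sup>d\<^sup>iV\<^sub>i\<close>, \<open>i \<in> I\<close>: tensors invariant under permuting,
  for each \<open>i\<close> separately, the \<open>d i\<close> slots of the \<open>i\<close>-th factor. For \<open>I = {}\<close> this is the field
  itself, since \<open>arg_space\<close> then has exactly one element.
\<close>

definition sym_tensors ::
  "('a::field \<Rightarrow> 'v::ab_group_add \<Rightarrow> 'v) \<Rightarrow> (nat \<Rightarrow> nat) \<Rightarrow> (nat \<Rightarrow> 'v set) \<Rightarrow> nat set
    \<Rightarrow> ('v, 'a) tensor set" where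
  "sym_tensors s d V I =
     {T. multilinear s d V I T \<and>
         (\<forall>f\<in>arg_space s d V I. \<forall>\<pi>. (\<forall>i\<in>I. \<pi> i permutes {..<d i}) \<longrightarrow>
            T (\<lambda>i\<in>I. f i \<circ> \<pi> i) = T f) \<and>
         (\<forall>f. f \<notin> arg_space s d V I \<longrightarrow> T f = 0)}"

text \<open>The tensor \<open>\<Otimes>\<^sub>i v\<^sub>i\<^sup>\<otimes>\<^sup>d\<^sup>i\<close>.\<close>

definition power_tensor ::
  "('a::field \<Rightarrow> 'v::ab_group_add \<Rightarrow> 'v) \<Rightarrow> (nat \<Rightarrow> nat) \<Rightarrow> (nat \<Rightarrow> 'v set) \<Rightarrow> nat set
    \<Rightarrow> (nat \<Rightarrow> 'v) \<Rightarrow> ('v, 'a) tensor" where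
  "power_tensor s d V I v =
     (\<lambda>f. if f \<in> arg_space s d V I then \<Prod>i\<in>I. \<Prod>a<d i. f i a (v i) else 0)"

text \<open>The product of \<open>x\<^sup>\<otimes>\<^sup>d\<^sup>i\<close>, in the \<open>i\<close>-th position, with a tensor \<open>q\<close> in the factors \<open>I - {i}\<close>.\<close>

definition insert_power ::
  "('a::field \<Rightarrow> 'v::ab_group_add \<Rightarrow> 'v) \<Rightarrow> (nat \<Rightarrow> nat) \<Rightarrow> (nat \<Rightarrow> 'v set) \<Rightarrow> nat set
    \<Rightarrow> nat \<Rightarrow> 'v \<Rightarrow> ('v, 'a) tensor \<Rightarrow> ('v, 'a) tensor" where
  "insert_power s d V I i x q =
     (\<lambda>f. if f \<in> arg_space s d V I
          then (\<Prod>a<d i. f i a x) * q (restrict f (I - {i})) else 0)"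

definition depends_on_factor ::
  "('a::field \<Rightarrow> 'v::ab_group_add \<Rightarrow> 'v) \<Rightarrow> (nat \<Rightarrow> nat) \<Rightarrow> (nat \<Rightarrow> 'v set) \<Rightarrow> nat set
    \<Rightarrow> ('v, 'a) tensor \<Rightarrow> nat \<Rightarrow> bool" where
  "depends_on_factor s d V I p i \<longleftrightarrow>
     \<not> (\<exists>x\<in>V i. \<exists>q\<in>sym_tensors s d V (I - {i}). p = insert_power s d V I i x q)"

definition sv_rank ::
  "('a::field \<Rightarrow> 'v::ab_group_add \<Rightarrow> 'v) \<Rightarrow> (nat \<Rightarrow> nat) \<Rightarrow> (nat \<Rightarrow> 'v set) \<Rightarrow> nat set
    \<Rightarrow> ('v, 'a) tensor \<Rightarrow> nat" where
  "sv_rank s d V I p =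
     (LEAST r. \<exists>(c :: nat \<Rightarrow> 'a) (v :: nat \<Rightarrow> nat \<Rightarrow> 'v).
        (\<forall>j<r. \<forall>i\<in>I. v j i \<in> V i) \<and>
        p = (\<lambda>f. \<Sum>j<r. c j * power_tensor s d V I (v j) f))"


section \<open>Projective varieties in the projectivization of a space of functions\<close>

text \<open>
  A vector of \<open>W\<close> is a function \<open>w :: 'x \<Rightarrow> 'a\<close>, whose values \<open>w x\<close> serve as coordinates. Polynomials
  are formal polynomials in variables indexed by \<open>'x\<close>: an element of \<open>('x \<Rightarrow>\<^sub>0 nat) \<Rightarrow>\<^sub>0 'a\<close> maps each
  monomial (exponent function) to its coefficient. If \<open>W\<close> is finite-dimensional, then the coordinates
  span the dual space of \<open>W\<close>, so these polynomials induce all polynomial functions on \<open>W\<close>, even when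
  the coordinates are infinite in number or linearly dependent on \<open>W\<close>.
\<close>

type_synonym ('x, 'a) mpolynomial = "('x \<Rightarrow>\<^sub>0 nat) \<Rightarrow>\<^sub>0 'a"

definition mon_eval :: "('x \<Rightarrow>\<^sub>0 nat) \<Rightarrow> ('x \<Rightarrow> 'a::field) \<Rightarrow> 'a" where
  "mon_eval m w = (\<Prod>x\<in>Poly_Mapping.keys m. w x ^ Poly_Mapping.lookup m x)"

definition mp_eval :: "('x, 'a::field) mpolynomial \<Rightarrow> ('x \<Rightarrow> 'a) \<Rightarrow> 'a" where
  "mp_eval F w = (\<Sum>m\<in>Poly_Mapping.keys F. Poly_Mapping.lookup F m * mon_eval m w)"

text \<open>The differential of \<open>F\<close> at \<open>q\<close> applied to \<open>w\<close>, i.e. \<open>\<Sum>\<^sub>x (\<partial>F/\<partial>x)(q) * w x\<close>.\<close>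

definition mon_diff :: "('x \<Rightarrow>\<^sub>0 nat) \<Rightarrow> ('x \<Rightarrow> 'a::field) \<Rightarrow> ('x \<Rightarrow> 'a) \<Rightarrow> 'a" where
  "mon_diff m q w =
     (\<Sum>x\<in>Poly_Mapping.keys m.
        of_nat (Poly_Mapping.lookup m x) * q x ^ (Poly_Mapping.lookup m x - 1) *
        (\<Prod>y\<in>Poly_Mapping.keys m - {x}. q y ^ Poly_Mapping.lookup m y) * w x)"

definition mp_diff :: "('x, 'a::field) mpolynomial \<Rightarrow> ('x \<Rightarrow> 'a) \<Rightarrow> ('x \<Rightarrow> 'a) \<Rightarrow> 'a" where
  "mp_diff F q w = (\<Sum>m\<in>Poly_Mapping.keys F. Poly_Mapping.lookup F m * mon_diff m q w)"

definition mp_homogeneous :: "('x, 'a::field) mpolynomial \<Rightarrow> bool" where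
  "mp_homogeneous F \<longleftrightarrow>
     (\<exists>e. \<forall>m\<in>Poly_Mapping.keys F. (\<Sum>x\<in>Poly_Mapping.keys m. Poly_Mapping.lookup m x) = e)"

definition proj_class :: "('x \<Rightarrow> 'a::field) \<Rightarrow> ('x \<Rightarrow> 'a) set" where
  "proj_class p = {\<lambda>x. c * p x | c. c \<noteq> 0}"

definition proj_space :: "('x \<Rightarrow> 'a::field) set \<Rightarrow> ('x \<Rightarrow> 'a) set set" where
  "proj_space W = {proj_class p | p. p \<in> W \<and> p \<noteq> (\<lambda>_. 0)}"

definition proj_zeros ::
  "('x \<Rightarrow> 'a::field) set \<Rightarrow> ('x, 'a) mpolynomial set \<Rightarrow> ('x \<Rightarrow> 'a) set set" where
  "proj_zeros W \<F> = {P\<in>proj_space W. \<forall>F\<in>\<F>. \<forall>p\<in>P. mp_eval F p = 0}"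

definition proj_zariski_closed :: "('x \<Rightarrow> 'a::field) set \<Rightarrow> ('x \<Rightarrow> 'a) set set \<Rightarrow> bool" where
  "proj_zariski_closed W Z \<longleftrightarrow> (\<exists>\<F>. (\<forall>F\<in>\<F>. mp_homogeneous F) \<and> Z = proj_zeros W \<F>)"

definition proj_zariski_closure ::
  "('x \<Rightarrow> 'a::field) set \<Rightarrow> ('x \<Rightarrow> 'a) set set \<Rightarrow> ('x \<Rightarrow> 'a) set set" where
  "proj_zariski_closure W S = \<Inter>{Z. proj_zariski_closed W Z \<and> S \<subseteq> Z}"

text \<open>The homogeneous elements of the ideal of \<open>X\<close>; they generate it.\<close>

definition homogeneous_ideal :: "('x \<Rightarrow> 'a::field) set set \<Rightarrow> ('x, 'a) mpolynomial set" where
  "homogeneous_ideal X = {F. mp_homogeneous F \<and> (\<forall>P\<in>X. \<forall>p\<in>P. mp_eval F p = 0)}"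

text \<open>
  The Zariski tangent space at \<open>Q\<close>, as a projective linear subspace: the common zeros of the
  differentials at \<open>Q\<close> of all equations of \<open>X\<close>. It contains \<open>Q\<close> by Euler's formula.
\<close>

definition proj_tangent_space ::
  "('x \<Rightarrow> 'a::field) set \<Rightarrow> ('x \<Rightarrow> 'a) set set \<Rightarrow> ('x \<Rightarrow> 'a) set \<Rightarrow> ('x \<Rightarrow> 'a) set set" where
  "proj_tangent_space W X Q =
     {P\<in>proj_space W. \<forall>F\<in>homogeneous_ideal X. \<forall>q\<in>Q. \<forall>w\<in>P. mp_diff F q w = 0}"

definition tangential_variety ::
  "('x \<Rightarrow> 'a::field) set \<Rightarrow> ('x \<Rightarrow> 'a) set set \<Rightarrow> ('x \<Rightarrow> 'a) set set" where
  "tangential_variety W X = proj_zariski_closure W (\<Union>Q\<in>X. proj_tangent_space W X Q)"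

definition segre_veronese ::
  "('a::field \<Rightarrow> 'v::ab_group_add \<Rightarrow> 'v) \<Rightarrow> (nat \<Rightarrow> nat) \<Rightarrow> (nat \<Rightarrow> 'v set) \<Rightarrow> nat set
    \<Rightarrow> ('v, 'a) tensor set set" where
  "segre_veronese s d V I =
     {proj_class (power_tensor s d V I v) | v. \<forall>i\<in>I. v i \<in> V i \<and> v i \<noteq> 0}"

end

(*
  The quadrics x_f x_g = x_f' x_g', where f' and g' arise from f and g by exchanging the entries of one
  slot, vanish on X and force every vector of the Zariski tangent space at v into the form
  sum_i v_1^d_1 ... (v_i^(d_i - 1) u_i) ... v_k^d_k. This form survives the closure: Chevalley's extension
  theorem, for the ring of all functions on the set of tangent vectors, turns a point of the closure into
  a generalized limit of tangent vectors, and after dividing v_i by a coordinate of least valuation all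
  terms converge. The point being outside X, it depends on the i-th factor iff u_i is not a multiple of
  v_i, and u_i may be taken to be 0 for the other factors. With N the sum of the d_i over the dependent
  factors, the upper bound comes from interpolating the curve of the powers of v + t u at the N-th roots
  of unity, and the lower bound from the rank of the W-state in the Segre product of N factors.
*)

theory Submission
  imports Defs "HOL-Library.Function_Algebras"
begin

text \<open>A point of the closure is approached by tangent vectors whose data \<open>v\<close> and
  \<open>u\<close> may diverge. The vector \<open>u\<close> is eliminated by reading it off from
  values of the tensor near a normalised argument: these are coordinates and converge by themselves.
  So only the lines spanned by the \<open>v i\<close> need compactness, and a place supplies it. Its
  price is a ring with zero divisors, in which a quotient by a coordinate is meaningful only off the
  zero set of that coordinate; indicator functions, which are idempotents, record where an identity
  holds generically.

  Both rank bounds count slots of the dependent factors, so \<open>u\<close> has to vanish in all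
  other factors. Multiples of \<open>v\<close> can be moved from one factor to another, with weights
  \<open>d i\<close> that have to be inverted. That \<open>p\<close> represents no point of X
  excludes a total of at most one slot, where interpolation at roots of unity could not separate the
  exponents 0 and 1.\<close>

lemma poly_eq_sum_atMost:
  fixes x :: "'a::comm_semiring_1"
  assumes "degree g \<le> n"
  shows "poly g x = (\<Sum>i\<le>n. coeff g i * x ^ i)"
  unfolding poly_altdef using assms
  by (intro sum.mono_neutral_left) (auto simp: coeff_eq_0)

section \<open>Places on a ring of functions\<close>

text \<open>
  The graph of a homomorphism from a subring onto the field. Rings of all functions \<open>Y \<rightarrow> K\<close> will take
  the role of the function field in Chevalley's extension theorem, which avoids parametrising \<open>Y\<close>.
\<close>

definition partial_hom :: "('r::comm_ring_1 \<times> 'a::field) set \<Rightarrow> bool" where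
  "partial_hom G \<longleftrightarrow> (\<forall>c. (0, c) \<in> G \<longrightarrow> c = 0) \<and> (1, 1) \<in> G \<and> (\<forall>c. \<exists>b. (b, c) \<in> G) \<and>
     (\<forall>x a y b. (x, a) \<in> G \<longrightarrow> (y, b) \<in> G \<longrightarrow>
        (x + y, a + b) \<in> G \<and> (x - y, a - b) \<in> G \<and> (x * y, a * b) \<in> G)"

locale maximal_partial_hom =
  fixes G :: "('r::comm_ring_1 \<times> 'a::alg_closed_field) set"
  assumes hom: "partial_hom G"
    and maximal: "\<And>G'. partial_hom G' \<Longrightarrow> G \<subseteq> G' \<Longrightarrow> G' = G"
begin

lemma zero_unique: "(0, c) \<in> G \<Longrightarrow> c = 0"
  and one_mem: "(1, 1) \<in> G"
  and surj: "\<exists>b. (b, c) \<in> G"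
  and add_mem: "(x, a) \<in> G \<Longrightarrow> (y, b) \<in> G \<Longrightarrow> (x + y, a + b) \<in> G"
  and diff_mem: "(x, a) \<in> G \<Longrightarrow> (y, b) \<in> G \<Longrightarrow> (x - y, a - b) \<in> G"
  and mult_mem: "(x, a) \<in> G \<Longrightarrow> (y, b) \<in> G \<Longrightarrow> (x * y, a * b) \<in> G"
  using hom unfolding partial_hom_def by blast+

lemma unique: "(x, a) \<in> G \<Longrightarrow> (x, b) \<in> G \<Longrightarrow> a = b"
  using zero_unique[of "a - b"] diff_mem[of x a x b] by simp

lemma zero_mem: "(0, 0) \<in> G"
  using diff_mem[OF one_mem one_mem] by simp

lemma sum_mem: "(\<And>i. i \<in> S \<Longrightarrow> (f i, h i) \<in> G) \<Longrightarrow> (sum f S, sum h S) \<in> G"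
  by (induction S rule: infinite_finite_induct) (auto intro: zero_mem add_mem)

lemma prod_mem: "(\<And>i. i \<in> S \<Longrightarrow> (f i, h i) \<in> G) \<Longrightarrow> (prod f S, prod h S) \<in> G"
  by (induction S rule: infinite_finite_induct) (auto intro: one_mem mult_mem)

lemma power_mem: "(x, a) \<in> G \<Longrightarrow> (x ^ n, a ^ n) \<in> G"
  by (induction n) (auto intro: one_mem mult_mem)

definition lifts :: "'r poly \<Rightarrow> 'a poly \<Rightarrow> bool" where
  "lifts g q \<longleftrightarrow> (\<forall>i. (coeff g i, coeff q i) \<in> G)"

lemma lifts_add: "lifts g q \<Longrightarrow> lifts g' q' \<Longrightarrow> lifts (g + g') (q + q')"
  and lifts_diff: "lifts g q \<Longrightarrow> lifts g' q' \<Longrightarrow> lifts (g - g') (q - q')"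
  and lifts_mult: "lifts g q \<Longrightarrow> lifts g' q' \<Longrightarrow> lifts (g * g') (q * q')"
  unfolding lifts_def coeff_mult by (auto intro!: add_mem diff_mem mult_mem sum_mem)

lemma lifts_const: "(x, a) \<in> G \<Longrightarrow> lifts [:x:] [:a:]"
  unfolding lifts_def by (auto simp: coeff_pCons zero_mem split: nat.split)

lemma lifts_X: "lifts [:0, 1:] [:0, 1:]"
  unfolding lifts_def by (auto simp: coeff_pCons zero_mem one_mem split: nat.split)

lemma lifts_surj: "\<exists>g. lifts g q"
proof (induction q)
  case 0
  then show ?case using zero_mem by (auto simp: lifts_def intro!: exI[of _ 0])
next
  case (pCons a q)
  then obtain g b where "lifts g q" "(b, a) \<in> G" using surj by blast
  then have "lifts (pCons b g) (pCons a q)"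
    unfolding lifts_def by (auto simp: coeff_pCons split: nat.split)
  then show ?case by blast
qed

lemma poly_mem: "lifts g q \<Longrightarrow> (x, a) \<in> G \<Longrightarrow> (poly g x, poly q a) \<in> G"
proof -
  assume *: "lifts g q" "(x, a) \<in> G"
  have "(\<Sum>i\<le>max (degree g) (degree q). coeff g i * x ^ i,
         \<Sum>i\<le>max (degree g) (degree q). coeff q i * a ^ i) \<in> G"
    using * by (auto intro!: sum_mem mult_mem power_mem simp: lifts_def)
  moreover have "poly g x = (\<Sum>i\<le>max (degree g) (degree q). coeff g i * x ^ i)"
    by (rule poly_eq_sum_atMost) auto
  moreover have "poly q a = (\<Sum>i\<le>max (degree g) (degree q). coeff q i * a ^ i)"
    by (rule poly_eq_sum_atMost) auto
  ultimately show ?thesis by simp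
qed

text \<open>
  If no relation of \<open>x\<close> over the domain reduces to \<open>1\<close>, then the reduced relations form a
  proper ideal of \<open>K[t]\<close>, and \<open>x\<close> can be sent to a common root of that ideal.
\<close>

lemma relation_if_undefined:
  assumes "x \<notin> Domain G"
  obtains g where "lifts g 1" "poly g x = 0"
proof -
  define J where "J = {q. \<exists>g. lifts g q \<and> poly g x = 0}"
  have J_mult: "r * q \<in> J" if q: "q \<in> J" for q r
  proof -
    obtain g g' where "lifts g q" "poly g x = 0" "lifts g' r"
      using q lifts_surj unfolding J_def by blast
    then show ?thesis
      unfolding J_def by (auto intro!: exI[of _ "g' * g"] lifts_mult)
  qed
  have J_diff: "q - r \<in> J" if J: "q \<in> J" "r \<in> J" for q r
  proof -
    obtain g g' where "lifts g q" "poly g x = 0" "lifts g' r" "poly g' x = 0"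
      using J unfolding J_def by blast
    then show ?thesis
      unfolding J_def by (auto intro!: exI[of _ "g - g'"] lifts_diff)
  qed
  have no_root: "\<exists>q\<in>J. poly q \<xi> \<noteq> 0" for \<xi>
  proof (rule ccontr)
    assume "\<not> ?thesis"
    then have root: "\<And>g q. lifts g q \<Longrightarrow> poly g x = 0 \<Longrightarrow> poly q \<xi> = 0"
      unfolding J_def by blast
    \<comment> \<open>The extension of \<open>G\<close> to the ring generated by its domain and
      \<open>x\<close>, with \<open>x\<close> sent to \<open>\<xi>\<close>. That
      \<open>\<xi>\<close> is a root of every reduced relation says exactly that \<open>0\<close> is
      sent only to \<open>0\<close>.\<close>
    define G' where "G' = {(poly g x, poly q \<xi>) | g q. lifts g q}"
    have G'I: "(poly g x, poly q \<xi>) \<in> G'" if "lifts g q" for g q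
      using that unfolding G'_def by blast
    have sub: "G \<subseteq> G'"
    proof (clarify)
      fix y a assume "(y, a) \<in> G"
      then show "(y, a) \<in> G'" using G'I[OF lifts_const[of y a]] by simp
    qed
    have "partial_hom G'"
      unfolding partial_hom_def
    proof (intro conjI allI impI)
      show "c = 0" if "(0, c) \<in> G'" for c
        using that root unfolding G'_def by auto
      show "(1, 1) \<in> G'" using sub one_mem by blast
      show "\<exists>b. (b, c) \<in> G'" for c using sub surj by blast
      fix y a z b assume "(y, a) \<in> G'" "(z, b) \<in> G'"
      then obtain g q g' q' where *: "lifts g q" "lifts g' q'"
        "y = poly g x" "a = poly q \<xi>" "z = poly g' x" "b = poly q' \<xi>"
        unfolding G'_def by blast
      show "(y + z, a + b) \<in> G'" using G'I[OF lifts_add[OF *(1,2)]] * by simp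
      show "(y - z, a - b) \<in> G'" using G'I[OF lifts_diff[OF *(1,2)]] * by simp
      show "(y * z, a * b) \<in> G'" using G'I[OF lifts_mult[OF *(1,2)]] * by simp
    qed
    then have "G' = G" using maximal sub by blast
    moreover have "(x, \<xi>) \<in> G'" using G'I[OF lifts_X] by simp
    ultimately show False using assms by blast
  qed
  then obtain q1 where "q1 \<in> J" "q1 \<noteq> 0" by (metis poly_0)
  then obtain q0 where q0: "q0 \<in> J" "q0 \<noteq> 0"
    and min: "\<And>q. q \<in> J \<Longrightarrow> q \<noteq> 0 \<Longrightarrow> degree q0 \<le> degree q"
    using arg_min_nat_lemma[of "\<lambda>q. q \<in> J \<and> q \<noteq> 0" q1 degree] by blast
  have dvd: "q0 dvd q" if "q \<in> J" for q
  proof -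
    have "q mod q0 \<in> J"
      using J_diff[OF that J_mult[OF q0(1), of "q div q0"]]
      by (simp add: minus_div_mult_eq_mod)
    then have "q mod q0 = 0"
      using min degree_mod_less[OF q0(2), of q] by force
    then show ?thesis by (simp add: dvd_eq_mod_eq_0)
  qed
  have "degree q0 = 0"
  proof (rule ccontr)
    assume "degree q0 \<noteq> 0"
    then obtain \<xi> where "poly q0 \<xi> = 0"
      using alg_closed_imp_poly_has_root by blast
    then show False using no_root[of \<xi>] dvd by (meson poly_eq_0_iff_dvd dvd_trans)
  qed
  then obtain c where "q0 = [:c:]" "c \<noteq> 0"
    using q0(2) by (metis degree_eq_zeroE pCons_0_0)
  then have "1 \<in> J" using J_mult[OF q0(1), of "[:inverse c:]"] by (simp add: one_pCons)
  then show ?thesis using that unfolding J_def by blast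
qed

text \<open>Replaces the absence of zero divisors: an element with nonzero limit behaves like a
  nonzero element of a field. Multiplying a relation of \<open>x\<close> by \<open>z\<close> leaves
  only the constant term, whose limit \<open>\<zeta>\<close> is not 0.\<close>

lemma annihilated_mem:
  assumes "(z, \<zeta>) \<in> G" "\<zeta> \<noteq> 0" "x * z = 0"
  shows "(x, 0) \<in> G"
proof -
  have "x \<in> Domain G"
  proof (rule ccontr)
    assume "x \<notin> Domain G"
    then obtain g where g: "lifts g 1" "poly g x = 0" by (rule relation_if_undefined)
    obtain a g' where gp: "g = pCons a g'" by (cases g)
    have "(a, 1) \<in> G" using g(1)[unfolded lifts_def gp, rule_format, of 0] by simp
    moreover have "z * a = 0"
      using g(2) assms(3) unfolding gp
      by (metis add.right_neutral distrib_left mult.assoc mult.commute mult_zero_left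
          mult_zero_right poly_pCons)
    ultimately show False
      using assms mult_mem[of z \<zeta> a 1] zero_unique by fastforce
  qed
  then obtain \<xi> where "(x, \<xi>) \<in> G" by blast
  moreover from this have "\<xi> * \<zeta> = 0" using mult_mem[OF _ assms(1)] assms(3) zero_unique by metis
  ultimately show ?thesis using assms(2) by simp
qed

text \<open>With \<open>e\<close> the indicator of a generic set, functions that agree on this set
  have the same limit. Identities that hold only where denominators do not vanish pass to the limit
  this way.\<close>

lemma eventually_eq_mem:
  assumes "(e, 1) \<in> G" "x * e = x' * e" "(x, a) \<in> G"
  shows "(x', a) \<in> G"
proof -
  have "(x' - x, 0) \<in> G"
    by (rule annihilated_mem[OF assms(1)]) (use assms(2) in \<open>auto simp: left_diff_distrib\<close>)
  then show ?thesis using add_mem[OF _ assms(3)] by fastforce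
qed

text \<open>A polynomial in an idempotent is determined by its values at 0 and 1. If it vanishes,
  the product of these two values is 0, although for a relation both reduce to 1. Applied to
  indicators: every set is either generic or negligible, as for an ultrafilter.\<close>

lemma idempotent_mem:
  assumes "e * e = e"
  shows "(e, 0) \<in> G \<or> (e, 1) \<in> G"
proof -
  have poly_e: "poly g e = poly g 0 * (1 - e) + poly g 1 * e" for g
  proof (induction g)
    case (pCons a g)
    have "e * poly g e = poly g 0 * (e - e * e) + poly g 1 * (e * e)"
      unfolding pCons.IH by (simp add: algebra_simps)
    then show ?case using assms by (simp add: algebra_simps)
  qed simp
  have "e \<in> Domain G"
  proof (rule ccontr)
    assume "e \<notin> Domain G"
    then obtain g where g: "lifts g 1" "poly g e = 0" by (rule relation_if_undefined)
    let ?u = "poly g 0" and ?w = "poly g 1"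
    have u: "(?u, 1) \<in> G" and w: "(?w, 1) \<in> G"
      using poly_mem[OF g(1) zero_mem] poly_mem[OF g(1) one_mem] by auto
    have 0: "?u * (1 - e) + ?w * e = 0" using g(2) poly_e by simp
    have "?w * e = (?u * (1 - e) + ?w * e) * e"
      using assms by (simp add: distrib_right right_diff_distrib left_diff_distrib mult.assoc)
    then have we: "?w * e = 0" using 0 by simp
    then have "?u = ?u * e" using 0 by (simp add: right_diff_distrib)
    then have "?u * ?w = ?u * (?w * e)" by (metis mult.assoc mult.commute)
    then have "?u * ?w = 0" using we by simp
    then show False using mult_mem[OF u w] zero_unique by fastforce
  qed
  then obtain \<epsilon> where \<epsilon>: "(e, \<epsilon>) \<in> G" by blast
  then have "\<epsilon> * \<epsilon> = \<epsilon>" using mult_mem[OF \<epsilon> \<epsilon>] assms unique by metis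
  then show ?thesis using \<epsilon> by auto
qed

text \<open>
  The classical argument for places: of two relations witnessing that neither \<open>x\<close> nor its inverse
  lies in the domain, the shorter one can be used to shorten the longer one.
\<close>

lemma no_two_relations:
  assumes "(\<Sum>i\<le>n. u i * x ^ i) = 0" "(\<Sum>i\<le>l. w i * y ^ i) = 0"
    and "\<And>i. (u i, if i = 0 then 1 else 0) \<in> G" "\<And>i. (w i, if i = 0 then 1 else 0) \<in> G"
    and "x * y * x = x" "y * x * y = y"
  shows False
  using assms
proof (induction "n + l" arbitrary: n l u w x y rule: less_induct)
  case less
  have step: False
    if "l \<le> n" and u: "(\<Sum>i\<le>n. u i * x ^ i) = 0" and w: "(\<Sum>i\<le>l. w i * y ^ i) = 0"
      and ug: "\<And>i. (u i, if i = 0 then 1 else 0) \<in> G"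
      and wg: "\<And>i. (w i, if i = 0 then 1 else 0) \<in> G"
      and xy: "x * y * x = x" and yx: "y * x * y = y"
      and IH: "\<And>n' u'. n' < n \<Longrightarrow> (\<Sum>i\<le>n'. u' i * x ^ i) = 0 \<Longrightarrow>
         (\<And>i. (u' i, if i = 0 then 1 else 0) \<in> G) \<Longrightarrow> False"
    for n l :: nat and u w x y
  proof (cases n)
    case 0
    then show False using u ug[of 0] zero_unique[of 1] by simp
  next
    case (Suc m)
    \<comment> \<open>As \<open>y\<close> is only a pseudo-inverse of \<open>x\<close>, the product
      is not 1 but an idempotent that acts as a unit on the positive powers of \<open>x\<close> and
      \<open>y\<close>.\<close>
    define e where "e = x * y"
    have ee: "e * e = e" unfolding e_def using xy by (metis mult.assoc)
    have e_dom: "e \<in> Domain G" using idempotent_mem[OF ee] by blast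
    have ex: "e * x = x" and ey: "e * y = y"
      using xy yx by (auto simp: e_def ac_simps)
    have pow: "e * x ^ j = x ^ j" if "j > 0" for j
      using that ex by (cases j) (auto simp: mult.assoc[symmetric])
    have xjyj: "x ^ j * y ^ j = (if j = 0 then 1 else e)" for j
    proof (induction j)
      case (Suc j)
      have "x ^ Suc j * y ^ Suc j = (x ^ j * y ^ j) * e" by (simp add: e_def ac_simps)
      then show ?case using Suc ee by simp
    qed simp
    have xnyi: "x ^ n * y ^ i = x ^ (n - i) * (if i = n then e else 1)" if "i \<le> n" for i
    proof -
      have "x ^ n * y ^ i = x ^ (n - i) * (x ^ i * y ^ i)"
        using that by (simp add: mult.assoc[symmetric] power_add[symmetric])
      also have "\<dots> = x ^ (n - i) * (if i = n then e else 1)"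
        using that Suc pow[of "n - i"] by (auto simp: xjyj mult.commute)
      finally show ?thesis .
    qed
    define w' where "w' i = (if i \<le> l then w i else 0)" for i
    have w'g: "(w' i, if i = 0 then 1 else 0) \<in> G" for i
      using wg[of i] zero_mem by (auto simp: w'_def)
    have "(\<Sum>i\<le>n. w' i * y ^ i) = (\<Sum>i\<le>l. w i * y ^ i)"
      using \<open>l \<le> n\<close> by (intro sum.mono_neutral_cong_right) (auto simp: w'_def)
    then have w'0: "(\<Sum>i\<le>n. w' i * y ^ i) = 0" using w by simp
    \<comment> \<open>These are the coefficients of \<open>w' 0\<close> times the relation of
      \<open>x\<close> minus \<open>u n * x ^ n\<close> times the relation of \<open>y\<close>. The
      terms of degree \<open>n\<close> cancel; the factor \<open>e\<close> appears only in degree 0,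
      from \<open>x ^ n * y ^ n = e\<close>. The reductions keep their pattern because
      \<open>n > 0\<close> makes \<open>u n\<close> reduce to 0.\<close>
    define u' where "u' i = w' 0 * u i - u n * w' (n - i) * (if i = 0 then e else 1)" for i
    have "0 = u n * (x ^ n * (\<Sum>i\<le>n. w' i * y ^ i))" using w'0 by simp
    also have "\<dots> = (\<Sum>i\<le>n. u n * (w' i * (x ^ n * y ^ i)))"
      by (simp add: sum_distrib_left ac_simps)
    also have "\<dots> = (\<Sum>i\<le>n. u n * w' i * x ^ (n - i) * (if i = n then e else 1))"
      by (intro sum.cong) (simp_all add: xnyi ac_simps)
    also have "\<dots> = (\<Sum>i\<le>n. u n * w' (n - i) * x ^ i * (if i = 0 then e else 1))"
      by (rule sum.reindex_bij_witness[of _ "\<lambda>i. n - i" "\<lambda>i. n - i"]) auto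
    finally have *: "(\<Sum>i\<le>n. u n * w' (n - i) * x ^ i * (if i = 0 then e else 1)) = 0" by simp
    have "(\<Sum>i\<le>n. u' i * x ^ i) = w' 0 * (\<Sum>i\<le>n. u i * x ^ i)
        - (\<Sum>i\<le>n. u n * w' (n - i) * x ^ i * (if i = 0 then e else 1))"
      unfolding u'_def sum_distrib_left sum_subtractf[symmetric]
      by (intro sum.cong) (simp_all add: left_diff_distrib right_diff_distrib mult.assoc mult.commute mult.left_commute
          split del: if_split)
    then have "(\<Sum>i\<le>n. u' i * x ^ i) = 0" using u * by simp
    then have "(\<Sum>i\<le>m. u' i * x ^ i) = 0"
      unfolding Suc by (simp add: u'_def Suc)
    moreover have "(if i \<le> m then u' i else 0, if i = 0 then 1 else 0) \<in> G" for i
    proof (cases "i \<le> m")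
      case True
      obtain \<epsilon> where \<epsilon>: "(if i = 0 then e else 1, \<epsilon>) \<in> G"
        using e_dom one_mem by (cases "i = 0") auto
      have "(u' i, 1 * (if i = 0 then 1 else 0) - 0 * 0 * \<epsilon>) \<in> G"
        unfolding u'_def using ug[of n] wg[of 0] w'g[of 0] w'g[of "n - i"] ug[of i] \<epsilon> Suc True
        by (intro diff_mem mult_mem) auto
      then show ?thesis using True by simp
    qed (simp add: zero_mem)
    moreover have "(\<Sum>i\<le>m. (if i \<le> m then u' i else 0) * x ^ i) = (\<Sum>i\<le>m. u' i * x ^ i)"
      by (intro sum.cong) auto
    ultimately show False using IH[of m "\<lambda>i. if i \<le> m then u' i else 0"] Suc by simp
  qed
  show False
  proof (cases "l \<le> n")
    case True
    show False
    proof (rule step[OF True less.prems])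
      fix n' u'
      assume "n' < n" "(\<Sum>i\<le>n'. u' i * x ^ i) = 0" "\<And>i. (u' i, if i = 0 then 1 else 0) \<in> G"
      then show False
        using less.hyps[of n' l u' x w y] less.prems by simp
    qed
  next
    case False
    then have "n \<le> l" by simp
    show False
    proof (rule step[OF \<open>n \<le> l\<close> less.prems(2,1,4,3,6,5)])
      fix n' u'
      assume "n' < l" "(\<Sum>i\<le>n'. u' i * y ^ i) = 0" "\<And>i. (u' i, if i = 0 then 1 else 0) \<in> G"
      then show False
        using less.hyps[of n n' u x u' y] less.prems by simp
    qed
  qed
qed

text \<open>The defining alternative of a valuation ring. The hypotheses hold for a pointwise
  quotient of functions and the reversed quotient, since division by zero yields zero.\<close>

lemma mem_or_inverse_mem:
  assumes "x * y * x = x" "y * x * y = y"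
  shows "x \<in> Domain G \<or> y \<in> Domain G"
proof (rule ccontr)
  assume "\<not> ?thesis"
  then obtain g h where gh: "lifts g 1" "poly g x = 0" "lifts h 1" "poly h y = 0"
    using relation_if_undefined by (metis (no_types))
  have "(coeff g i, if i = 0 then 1 else 0) \<in> G" "(coeff h i, if i = 0 then 1 else 0) \<in> G" for i
    using gh(1,3) unfolding lifts_def coeff_1 of_bool_def by metis+
  then show False
    using no_two_relations[of "coeff g" x "degree g" "coeff h" y "degree h"] gh(2,4) assms
    unfolding poly_altdef by blast
qed

end

text \<open>Each closure condition involves at most two pairs, which lie in a common member of a
  chain, so unions of chains are again homomorphisms and Zorn's lemma applies.\<close>

lemma maximal_partial_hom_exists:
  fixes G0 :: "('r::comm_ring_1 \<times> 'a::alg_closed_field) set"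
  assumes "partial_hom G0"
  obtains G where "maximal_partial_hom G" "G0 \<subseteq> G"
proof -
  define \<A> where "\<A> = {G. partial_hom G \<and> G0 \<subseteq> G}"
  have "\<exists>M\<in>\<A>. \<forall>X\<in>\<A>. M \<subseteq> X \<longrightarrow> X = M"
  proof (rule subset_Zorn_nonempty)
    show "\<A> \<noteq> {}" using assms unfolding \<A>_def by blast
    fix \<C> assume C: "\<C> \<noteq> {}" "subset.chain \<A> \<C>"
    then have hom: "partial_hom G" and sub: "G0 \<subseteq> G" if "G \<in> \<C>" for G
      using that unfolding \<A>_def subset.chain_def by blast+
    have pair: "\<exists>Z\<in>\<C>. s \<in> Z \<and> t \<in> Z" if "s \<in> \<Union>\<C>" "t \<in> \<Union>\<C>" for s t
      using that C(2) unfolding subset_chain_def by blast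
    obtain Z0 where Z0: "Z0 \<in> \<C>" using C(1) by blast
    have "partial_hom (\<Union>\<C>)"
      unfolding partial_hom_def
    proof (intro conjI allI impI)
      show "c = 0" if "(0, c) \<in> \<Union>\<C>" for c
        using that hom unfolding partial_hom_def by blast
      show "(1, 1) \<in> \<Union>\<C>" "\<exists>b. (b, c) \<in> \<Union>\<C>" for c
        using Z0 hom[OF Z0] unfolding partial_hom_def by blast+
      fix x a y b assume "(x, a) \<in> \<Union>\<C>" "(y, b) \<in> \<Union>\<C>"
      then obtain Z where "Z \<in> \<C>" "(x, a) \<in> Z" "(y, b) \<in> Z" using pair by blast
      then show "(x + y, a + b) \<in> \<Union>\<C>" "(x - y, a - b) \<in> \<Union>\<C>" "(x * y, a * b) \<in> \<Union>\<C>"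
        using hom unfolding partial_hom_def by blast+
    qed
    then show "\<Union>\<C> \<in> \<A>" using Z0 sub unfolding \<A>_def by blast
  qed
  then obtain M where "M \<in> \<A>" "\<And>X. X \<in> \<A> \<Longrightarrow> M \<subseteq> X \<Longrightarrow> X = M" by blast
  then have "maximal_partial_hom M" "G0 \<subseteq> M"
    unfolding \<A>_def maximal_partial_hom_def by blast+
  then show ?thesis using that by blast
qed

section \<open>Polynomials on a cone and generalized limits\<close>

lemma mon_eval_superset:
  assumes "finite S" "Poly_Mapping.keys m \<subseteq> S"
  shows "mon_eval m w = (\<Prod>x\<in>S. w x ^ Poly_Mapping.lookup m x)"
  unfolding mon_eval_def using assms by (intro prod.mono_neutral_left) (auto simp: in_keys_iff)

lemma mon_eval_add: "mon_eval (m + n) w = mon_eval m w * mon_eval n w"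
proof -
  let ?S = "Poly_Mapping.keys m \<union> Poly_Mapping.keys n"
  have "mon_eval (m + n) w = (\<Prod>x\<in>?S. w x ^ Poly_Mapping.lookup (m + n) x)"
    by (rule mon_eval_superset) (use Poly_Mapping.keys_add[of m n] in auto)
  also have "\<dots> = (\<Prod>x\<in>?S. w x ^ Poly_Mapping.lookup m x) * (\<Prod>x\<in>?S. w x ^ Poly_Mapping.lookup n x)"
    by (simp add: lookup_add power_add prod.distrib)
  also have "\<dots> = mon_eval m w * mon_eval n w"
    by (subst (1 2) mon_eval_superset[of ?S]) auto
  finally show ?thesis .
qed

lemma mon_eval_single: "mon_eval (Poly_Mapping.single x n) w = w x ^ n"
  unfolding mon_eval_def by (cases "n = 0") auto

lemma mon_eval_zero [simp]: "mon_eval 0 w = 1"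
  unfolding mon_eval_def by simp

definition mon_degree :: "('x \<Rightarrow>\<^sub>0 nat) \<Rightarrow> nat" where
  "mon_degree m = (\<Sum>x\<in>Poly_Mapping.keys m. Poly_Mapping.lookup m x)"

lemma mon_eval_scale: "mon_eval m (\<lambda>x. c * w x) = c ^ mon_degree m * mon_eval m w"
  unfolding mon_eval_def mon_degree_def by (simp add: power_mult_distrib prod.distrib power_sum)

lemma mp_eval_superset:
  assumes "finite S" "Poly_Mapping.keys F \<subseteq> S"
  shows "mp_eval F w = (\<Sum>m\<in>S. Poly_Mapping.lookup F m * mon_eval m w)"
  unfolding mp_eval_def using assms by (intro sum.mono_neutral_left) (auto simp: in_keys_iff)

lemma mp_eval_zero [simp]: "mp_eval 0 w = 0"
  unfolding mp_eval_def by simp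

lemma mp_eval_single: "mp_eval (Poly_Mapping.single m c) w = c * mon_eval m w"
  unfolding mp_eval_def by simp

lemma mp_eval_add: "mp_eval (F + H) w = mp_eval F w + mp_eval H w"
proof -
  let ?S = "Poly_Mapping.keys F \<union> Poly_Mapping.keys H"
  have "mp_eval (F + H) w = (\<Sum>x\<in>?S. Poly_Mapping.lookup (F + H) x * mon_eval x w)"
    by (rule mp_eval_superset) (use Poly_Mapping.keys_add[of F H] in auto)
  also have "\<dots> = mp_eval F w + mp_eval H w"
    by (subst (1 2) mp_eval_superset[of ?S]) (auto simp: lookup_add distrib_right sum.distrib)
  finally show ?thesis .
qed

lemma mp_eval_uminus: "mp_eval (- F) w = - mp_eval F w"
  unfolding mp_eval_def by (simp add: sum_negf)

lemma mp_eval_diff: "mp_eval (F - H) w = mp_eval F w - mp_eval H w"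
  using mp_eval_add[of F "- H" w] by (simp add: mp_eval_uminus)

lemma mp_eval_sum: "mp_eval (sum F S) w = (\<Sum>i\<in>S. mp_eval (F i) w)"
  by (induction S rule: infinite_finite_induct) (auto simp: mp_eval_add)

lemma poly_mapping_sum_singles:
  "(\<Sum>m\<in>Poly_Mapping.keys F. Poly_Mapping.single m (Poly_Mapping.lookup F m)) = F"
proof (rule poly_mapping_eqI)
  fix k
  show "Poly_Mapping.lookup (\<Sum>m\<in>Poly_Mapping.keys F.
      Poly_Mapping.single m (Poly_Mapping.lookup F m)) k = Poly_Mapping.lookup F k"
    by (auto simp: lookup_sum lookup_single when_def in_keys_iff)
qed

lemma mp_eval_mult: "mp_eval (F * H) w = mp_eval F w * mp_eval H w"
proof -
  have "F * H = (\<Sum>m\<in>Poly_Mapping.keys F. \<Sum>n\<in>Poly_Mapping.keys H.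
      Poly_Mapping.single (m + n) (Poly_Mapping.lookup F m * Poly_Mapping.lookup H n))"
    by (subst (1) poly_mapping_sum_singles[of F, symmetric],
        subst (1) poly_mapping_sum_singles[of H, symmetric])
      (simp add: sum_product mult_single)
  also have "mp_eval \<dots> w = mp_eval F w * mp_eval H w"
    unfolding mp_eval_sum mp_eval_single mp_eval_def[of F] mp_eval_def[of H] sum_product
    by (simp add: mon_eval_add ac_simps)
  finally show ?thesis .
qed

text \<open>
  On the line through a point of the cone, the values of \<open>F\<close> form a polynomial in the scaling factor
  whose coefficients are the values of the homogeneous components.
\<close>

lemma mp_eval_zero_of_homogeneous:
  fixes p :: "'x \<Rightarrow> 'a::field_char_0"
  assumes cone: "\<And>w c. w \<in> Y \<Longrightarrow> (\<lambda>x. c * w x) \<in> Y"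
    and hom: "\<And>H. mp_homogeneous H \<Longrightarrow> (\<forall>w\<in>Y. mp_eval H w = 0) \<Longrightarrow> mp_eval H p = 0"
    and zero: "\<And>w. w \<in> Y \<Longrightarrow> mp_eval F w = 0"
  shows "mp_eval F p = 0"
proof -
  define M where "M e = {m \<in> Poly_Mapping.keys F. mon_degree m = e}" for e
  define H where "H e = (\<Sum>m\<in>M e. Poly_Mapping.single m (Poly_Mapping.lookup F m))" for e
  define N where "N = Max (insert 0 (mon_degree ` Poly_Mapping.keys F))"
  have N: "mon_degree m \<le> N" if "m \<in> Poly_Mapping.keys F" for m
    unfolding N_def using that by (intro Max_ge) auto
  have eval_H: "mp_eval (H e) w = (\<Sum>m\<in>M e. Poly_Mapping.lookup F m * mon_eval m w)" for e w
    unfolding H_def by (simp add: mp_eval_sum mp_eval_single)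
  have decomp: "mp_eval F w = (\<Sum>e\<le>N. mp_eval (H e) w)" for w
  proof -
    have "(\<Sum>e\<le>N. mp_eval (H e) w) =
        (\<Sum>e\<le>N. \<Sum>m | m \<in> Poly_Mapping.keys F \<and> mon_degree m = e.
            Poly_Mapping.lookup F m * mon_eval m w)"
      by (simp add: eval_H M_def)
    also have "\<dots> = mp_eval F w"
      unfolding mp_eval_def by (rule sum.group) (auto intro: N)
    finally show ?thesis ..
  qed
  have homog: "mp_homogeneous (H e)" for e
  proof -
    have "Poly_Mapping.keys (H e) \<subseteq> M e"
      unfolding H_def by (rule order_trans[OF keys_sum]) auto
    then show ?thesis
      unfolding mp_homogeneous_def M_def mon_degree_def by (intro exI[of _ e]) auto
  qed
  have "mp_eval (H e) w = 0" if "w \<in> Y" "e \<le> N" for e w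
  proof -
    define P where "P = (\<Sum>e\<le>N. monom (mp_eval (H e) w) e)"
    have "poly P c = 0" for c
    proof -
      have "mp_eval (H e) (\<lambda>x. c * w x) = mp_eval (H e) w * c ^ e" for e
        unfolding eval_H by (simp add: mon_eval_scale M_def sum_distrib_left ac_simps)
      then have "poly P c = mp_eval F (\<lambda>x. c * w x)"
        unfolding P_def decomp by (simp add: poly_sum poly_monom)
      then show ?thesis using zero cone that by simp
    qed
    then have "P = 0" using poly_all_0_iff_0 by blast
    moreover have "coeff P e = mp_eval (H e) w"
      unfolding P_def using that by (simp add: coeff_sum)
    ultimately show ?thesis by simp
  qed
  then have "mp_eval (H e) p = 0" if "e \<le> N" for e
    using hom homog that by blast
  then show ?thesis by (simp add: decomp)
qed

text \<open>Evaluation at \<open>p\<close> is well defined on the polynomial functions on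
  \<open>Y\<close> because a polynomial vanishing on \<open>Y\<close> vanishes at \<open>p\<close>;
  a maximal extension assigns limits to further functions. Functions live on the whole type, but are
  compared only on \<open>Y\<close>, so the indicator of \<open>Y\<close> has limit 1.\<close>

lemma generalized_limit_exists:
  fixes p :: "'x \<Rightarrow> 'a::alg_closed_field"
  assumes "\<And>F. (\<forall>y\<in>Y. mp_eval F y = 0) \<Longrightarrow> mp_eval F p = 0"
  obtains G where "maximal_partial_hom G"
    "\<forall>F x. (\<forall>y\<in>Y. x y = mp_eval F y) \<longrightarrow> (x, mp_eval F p) \<in> G"
proof -
  define G0 where "G0 = {(x, mp_eval F p) | x F. \<forall>y\<in>Y. x y = mp_eval F y}"
  have G0I: "(x, mp_eval F p) \<in> G0" if "\<And>y. y \<in> Y \<Longrightarrow> x y = mp_eval F y" for x F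
    using that unfolding G0_def by blast
  have const: "(\<lambda>_. c, c) \<in> G0" for c
    using G0I[of "\<lambda>_. c" "Poly_Mapping.single 0 c"] by (simp add: mp_eval_single)
  have "partial_hom G0"
    unfolding partial_hom_def
  proof (intro conjI allI impI)
    show "c = 0" if "(0, c) \<in> G0" for c
      using that assms unfolding G0_def by auto
    show "(1, 1) \<in> G0" using const[of 1] by (simp add: one_fun_def)
    show "\<exists>b. (b, c) \<in> G0" for c using const by blast
    fix x a y b assume "(x, a) \<in> G0" "(y, b) \<in> G0"
    then obtain F H where *: "a = mp_eval F p" "b = mp_eval H p"
      "\<And>z. z \<in> Y \<Longrightarrow> x z = mp_eval F z" "\<And>z. z \<in> Y \<Longrightarrow> y z = mp_eval H z"
      unfolding G0_def by blast
    show "(x + y, a + b) \<in> G0"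
      using G0I[of "x + y" "F + H"] * by (simp add: mp_eval_add)
    show "(x - y, a - b) \<in> G0"
      using G0I[of "x - y" "F - H"] * by (simp add: mp_eval_diff)
    show "(x * y, a * b) \<in> G0"
      using G0I[of "x * y" "F * H"] * by (simp add: mp_eval_mult)
  qed
  then obtain G where "maximal_partial_hom G" "G0 \<subseteq> G"
    by (rule maximal_partial_hom_exists)
  then show ?thesis using that G0I by blast
qed

text \<open>
  The domain of \<open>G\<close> behaves like a valuation ring of \<open>K\<^sup>Y\<close>, in which an idempotent sent to \<open>1\<close> marks a
  set of points that counts as generic; \<open>l\<close> is a coordinate of least valuation.
\<close>

lemma pivot_exists:
  fixes G :: "(('y \<Rightarrow> 'a::alg_closed_field) \<times> 'a) set"
  assumes G: "maximal_partial_hom G" and "finite J"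
    and nonzero: "(\<lambda>y. of_bool (\<exists>j\<in>J. c j y \<noteq> 0), 1) \<in> G"
  obtains l where "l \<in> J" "(\<lambda>y. of_bool (c l y \<noteq> 0), 1) \<in> G"
    "\<And>j. j \<in> J \<Longrightarrow> (\<lambda>y. c j y / c l y) \<in> Domain G"
proof -
  interpret maximal_partial_hom G by (rule G)
  define e where "e j = (\<lambda>y. of_bool (c j y \<noteq> 0) :: 'a)" for j
  define R where "R j l \<longleftrightarrow> (\<lambda>y. c j y / c l y) \<in> Domain G" for j l
  define J' where "J' = {j \<in> J. (e j, 1) \<in> G}"
  have e01: "(e j, 0) \<in> G \<or> (e j, 1) \<in> G" for j
    by (rule idempotent_mem) (auto simp: e_def fun_eq_iff)
  have "J' \<noteq> {}"
  proof
    assume "J' = {}"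
    \<comment> \<open>If every \<open>c j\<close> vanished generically, so would all of them
      simultaneously, which is disjoint from the generic set of \<open>nonzero\<close>.\<close>
    then have "(1 - e j, 1 - 0) \<in> G" if "j \<in> J" for j
      using that e01[of j] diff_mem[OF one_mem, of "e j" 0] unfolding J'_def by auto
    then have "(\<Prod>j\<in>J. 1 - e j, \<Prod>j\<in>J. 1 - 0) \<in> G"
      by (rule prod_mem)
    then have "((\<lambda>y. of_bool (\<exists>j\<in>J. c j y \<noteq> 0)) * (\<Prod>j\<in>J. 1 - e j), 1) \<in> G"
      using mult_mem[OF nonzero] by fastforce
    moreover have "(\<lambda>y. of_bool (\<exists>j\<in>J. c j y \<noteq> 0)) * (\<Prod>j\<in>J. 1 - e j) = 0"
    proof
      fix y
      have "(\<Prod>j\<in>J. 1 - e j) y = (\<Prod>j\<in>J. 1 - e j y)"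
        by (induction J rule: infinite_finite_induct) auto
      then show "((\<lambda>y. of_bool (\<exists>j\<in>J. c j y \<noteq> 0)) * (\<Prod>j\<in>J. 1 - e j)) y = 0 y"
        using \<open>finite J\<close> by (auto simp: e_def)
    qed
    ultimately show False using zero_unique by fastforce
  qed
  have total: "R j l \<or> R l j" for j l
    unfolding R_def by (rule mem_or_inverse_mem) (auto simp: fun_eq_iff)
  have trans: "R j m" if jlm: "R j l" "R l m" "l \<in> J'" for j l m
  proof -
    \<comment> \<open>The two quotients multiply to \<open>?x\<close> only where \<open>c l\<close>
      is nonzero; \<open>l \<in> J'\<close> makes this set generic, and the difference is
      negligible.\<close>
    let ?x = "\<lambda>y. c j y / c m y"
    obtain a b where "(\<lambda>y. c j y / c l y, a) \<in> G" "(\<lambda>y. c l y / c m y, b) \<in> G"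
      using jlm unfolding R_def by blast
    then have "((\<lambda>y. c j y / c l y) * (\<lambda>y. c l y / c m y), a * b) \<in> G" by (rule mult_mem)
    moreover have "(\<lambda>y. c j y / c l y) * (\<lambda>y. c l y / c m y) = ?x * e l"
      by (auto simp: fun_eq_iff e_def)
    moreover have "(?x - ?x * e l, 0) \<in> G"
      by (rule annihilated_mem[of "e l" 1]) (use jlm in \<open>auto simp: J'_def fun_eq_iff e_def\<close>)
    ultimately have "(?x * e l + (?x - ?x * e l), a * b + 0) \<in> G"
      using add_mem by metis
    then show ?thesis unfolding R_def by auto
  qed
  have "\<exists>l\<in>S. \<forall>j\<in>S. R j l" if "finite S" "S \<noteq> {}" "S \<subseteq> J'" for S
    using that
  proof (induction S rule: finite_ne_induct)
    case (singleton x)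
    then show ?case using total by blast
  next
    case (insert x S)
    then obtain l where l: "l \<in> S" "\<And>j. j \<in> S \<Longrightarrow> R j l" by auto
    show ?case
    proof (cases "R x l")
      case False
      then have "R l x" using total by blast
      then have "R j x" if "j \<in> S" for j using trans l insert.prems that by blast
      then show ?thesis using total[of x x] by blast
    qed (use l in blast)
  qed
  then obtain l where l: "l \<in> J'" "\<And>j. j \<in> J' \<Longrightarrow> R j l"
    using \<open>J' \<noteq> {}\<close> \<open>finite J\<close> by (metis (no_types, lifting) J'_def finite_Collect_conjI finite_subset mem_Collect_eq order_refl subsetI)
  have "R j l" if "j \<in> J" for j
  proof (cases "j \<in> J'")
    case False
    \<comment> \<open>Coordinates outside \<open>J'\<close> vanish generically, so their quotients
      have limit 0.\<close>
    then have "(e j, 0) \<in> G" using that e01 unfolding J'_def by blast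
    then have "(1 - e j, 1 - 0) \<in> G" by (intro diff_mem one_mem)
    then have "(\<lambda>y. c j y / c l y, 0) \<in> G"
      by (rule annihilated_mem) (auto simp: fun_eq_iff e_def)
    then show ?thesis unfolding R_def by blast
  qed (use l in blast)
  then show ?thesis using that[of l] l(1) unfolding J'_def R_def e_def by auto
qed

section \<open>Dual spaces\<close>

lemma dual_space_add: "f \<in> dual_space s V \<Longrightarrow> x \<in> V \<Longrightarrow> y \<in> V \<Longrightarrow> f (x + y) = f x + f y"
  and dual_space_scale: "f \<in> dual_space s V \<Longrightarrow> x \<in> V \<Longrightarrow> f (s c x) = c * f x"
  and dual_space_outside: "f \<in> dual_space s V \<Longrightarrow> x \<notin> V \<Longrightarrow> f x = 0"
  unfolding dual_space_def by auto

lemma dual_space_plus: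
  "f \<in> dual_space s V \<Longrightarrow> g \<in> dual_space s V \<Longrightarrow> (\<lambda>x. f x + g x) \<in> dual_space s V"
  unfolding dual_space_def by (auto simp: algebra_simps)

lemma dual_space_times: "f \<in> dual_space s V \<Longrightarrow> (\<lambda>x. c * f x) \<in> dual_space s V"
  unfolding dual_space_def by (auto simp: algebra_simps)

lemma dual_space_0: "(\<lambda>x. 0) \<in> dual_space s V"
  unfolding dual_space_def by auto

lemma dual_space_sum:
  "(\<And>b. b \<in> S \<Longrightarrow> f b \<in> dual_space s V) \<Longrightarrow> (\<lambda>x. \<Sum>b\<in>S. f b x) \<in> dual_space s V"
  by (induction S rule: infinite_finite_induct) (auto intro: dual_space_0 dual_space_plus)

context vector_space
begin

lemma dual_space_sum_scale:
  assumes "fin_dim_subspace scale V" "f \<in> dual_space scale V" "\<And>b. b \<in> S \<Longrightarrow> x b \<in> V"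
  shows "f (\<Sum>b\<in>S. scale (c b) (x b)) = (\<Sum>b\<in>S. c b * f (x b))"
proof -
  have V: "subspace V" using assms(1) unfolding fin_dim_subspace_def by blast
  have f0: "f 0 = 0"
    using dual_space_scale[OF assms(2) subspace_0[OF V], of 0] by simp
  show ?thesis using assms(3)
  proof (induction S rule: infinite_finite_induct)
    case (insert b S)
    then have "scale (c b) (x b) \<in> V" "(\<Sum>b\<in>S. scale (c b) (x b)) \<in> V"
      by (auto intro!: subspace_scale subspace_sum V)
    then show ?case
      using insert by (simp add: dual_space_add[OF assms(2)] dual_space_scale[OF assms(2)])
  qed (auto simp: f0)
qed

lemma dual_basis_exists:
  assumes "fin_dim_subspace scale V"
  obtains B e where "finite B" "B \<subseteq> V" "\<And>b. e b \<in> dual_space scale V"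
    "\<And>x. x \<in> V \<Longrightarrow> (\<Sum>b\<in>B. scale (e b x) b) = x"
proof -
  obtain B0 where B0: "finite B0" "V = span B0"
    using assms unfolding fin_dim_subspace_def by blast
  obtain B where B: "B \<subseteq> B0" "independent B" "B0 \<subseteq> span B"
    by (rule maximal_independent_subset[of B0])
  have V: "V = span B"
    using B B0(2) span_mono[of B B0] span_minimal[OF B(3) subspace_span] by blast
  define e where "e b x = (if x \<in> V then representation B x b else 0)" for b x
  show ?thesis
  proof (rule that)
    show "finite B" using B(1) B0(1) by (rule finite_subset)
    show "B \<subseteq> V" unfolding V by (rule span_superset)
    show "e b \<in> dual_space scale V" for b
      unfolding dual_space_def e_def V
      by (auto simp: representation_add[OF B(2)] representation_scale[OF B(2)] span_add span_scale)
    show "(\<Sum>b\<in>B. scale (e b x) b) = x" if "x \<in> V" for x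
      using sum_representation_eq[OF B(2) _ \<open>finite B\<close> order_refl, of x] that
      unfolding e_def V by simp
  qed
qed

lemma dual_space_separates:
  assumes "fin_dim_subspace scale V" "v \<in> V" "v \<noteq> 0"
  obtains f where "f \<in> dual_space scale V" "f v = 1"
proof -
  obtain B e where B: "finite B" "B \<subseteq> V" "\<And>b. e b \<in> dual_space scale V"
    "\<And>x. x \<in> V \<Longrightarrow> (\<Sum>b\<in>B. scale (e b x) b) = x"
    using dual_basis_exists[OF assms(1)] by metis
  obtain b where "e b v \<noteq> 0"
    using B(4)[OF assms(2)] assms(3) by (metis (no_types, lifting) scale_zero_left sum.neutral)
  then show ?thesis
    using that[OF dual_space_times[OF B(3), of "inverse (e b v)" b]] by simp
qed

lemma dual_space_separates_line:
  assumes "fin_dim_subspace scale V" "v \<in> V" "x \<in> V" "v \<noteq> 0" "\<And>c. x \<noteq> scale c v"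
  obtains f where "f \<in> dual_space scale V" "f v = 0" "f x = 1"
proof -
  obtain B e where B: "finite B" "B \<subseteq> V" "\<And>b. e b \<in> dual_space scale V"
    "\<And>x. x \<in> V \<Longrightarrow> (\<Sum>b\<in>B. scale (e b x) b) = x"
    using dual_basis_exists[OF assms(1)] by metis
  obtain h where h: "h \<in> dual_space scale V" "h v = 1"
    by (rule dual_space_separates[OF assms(1,2,4)])
  \<comment> \<open>Coordinate functionals corrected so as to vanish at \<open>v\<close>. If all of
    them killed \<open>x\<close>, then \<open>x\<close> would be \<open>h x\<close> times
    \<open>v\<close>.\<close>
  define k where "k b = (\<lambda>y. e b y + (- e b v) * h y)" for b
  have k: "k b \<in> dual_space scale V" "k b v = 0" for b
    using dual_space_plus[OF B(3)[of b] dual_space_times[OF h(1), of "- e b v"]] h(2)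
    unfolding k_def by simp_all
  have "\<exists>b. k b x \<noteq> 0"
  proof (rule ccontr)
    assume "\<not> ?thesis"
    then have "e b x = h x * e b v" for b by (simp add: k_def mult.commute)
    then have "x = scale (h x) (\<Sum>b\<in>B. scale (e b v) b)"
      using B(4)[OF assms(3)] by (simp add: scale_sum_right)
    then show False using B(4)[OF assms(2)] assms(5) by metis
  qed
  then obtain b where "k b x \<noteq> 0" by blast
  then show ?thesis
    using that[OF dual_space_times[OF k(1), of "inverse (k b x)" b]] k(2) by simp
qed

text \<open>The double dual of \<open>V\<close> is \<open>V\<close>: the vector has the coordinates
  \<open>L (e b)\<close>. This converts the dependence of a tensor on one slot into an actual
  vector.\<close>

lemma dual_space_reflexive:
  assumes "fin_dim_subspace scale V"
    and add: "\<And>f g. f \<in> dual_space scale V \<Longrightarrow> g \<in> dual_space scale V \<Longrightarrow>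
      L (\<lambda>x. f x + g x) = L f + L g"
    and times: "\<And>f c. f \<in> dual_space scale V \<Longrightarrow> L (\<lambda>x. c * f x) = c * L f"
  obtains u where "u \<in> V" "\<And>f. f \<in> dual_space scale V \<Longrightarrow> L f = f u"
proof -
  obtain B e where B: "finite B" "B \<subseteq> V" "\<And>b. e b \<in> dual_space scale V"
    "\<And>x. x \<in> V \<Longrightarrow> (\<Sum>b\<in>B. scale (e b x) b) = x"
    using dual_basis_exists[OF assms(1)] by metis
  have V: "subspace V" using assms(1) unfolding fin_dim_subspace_def by blast
  have L0: "L (\<lambda>x. 0) = 0" using times[OF dual_space_0, of 0] by simp
  have L_sum: "L (\<lambda>x. \<Sum>b\<in>S. c b * e b x) = (\<Sum>b\<in>S. c b * L (e b))" if "finite S" for S c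
    using that
    by induction (simp_all add: L0 add times B(3) dual_space_sum dual_space_times)
  show ?thesis
  proof (rule that)
    show "(\<Sum>b\<in>B. scale (L (e b)) b) \<in> V"
      using B(2) by (auto intro!: subspace_sum subspace_scale V)
    fix f assume f: "f \<in> dual_space scale V"
    have "f = (\<lambda>x. \<Sum>b\<in>B. f b * e b x)"
    proof
      fix x
      show "f x = (\<Sum>b\<in>B. f b * e b x)"
      proof (cases "x \<in> V")
        case True
        have "f x = f (\<Sum>b\<in>B. scale (e b x) b)" using B(4)[OF True] by simp
        also have "\<dots> = (\<Sum>b\<in>B. e b x * f b)"
          using B(2) by (intro dual_space_sum_scale[OF assms(1) f]) auto
        finally show ?thesis by (simp add: mult.commute)
      next
        case False
        then show ?thesis
          using dual_space_outside[OF f False] dual_space_outside[OF B(3) False] by simp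
      qed
    qed
    then have "L f = (\<Sum>b\<in>B. f b * L (e b))" using L_sum[OF B(1), of f] by simp
    also have "\<dots> = f (\<Sum>b\<in>B. scale (L (e b)) b)"
      using B(2) by (subst dual_space_sum_scale[OF assms(1) f]) (auto simp: mult.commute)
    finally show "L f = f (\<Sum>b\<in>B. scale (L (e b)) b)" .
  qed
qed

end

section \<open>Differentials of quadratic monomials and pointwise evaluation\<close>

lemma keys_single_plus_single:
  "x \<noteq> y \<Longrightarrow> Poly_Mapping.keys (Poly_Mapping.single x (1::nat) + Poly_Mapping.single y 1) = {x, y}"
  by (auto simp: in_keys_iff lookup_add lookup_single when_def split: if_splits)

text \<open>The product rule. Coinciding variables form a separate case, since they merge into one
  key of exponent 2.\<close>

lemma mon_diff_two:
  "mon_diff (Poly_Mapping.single x 1 + Poly_Mapping.single y 1) q w = q x * w y + q y * w x"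
proof (cases "x = y")
  case True
  have *: "Poly_Mapping.single y (1::nat) + Poly_Mapping.single y 1 = Poly_Mapping.single y 2"
    by (simp add: single_add[symmetric] numeral_2_eq_2)
  show ?thesis unfolding True * mon_diff_def by simp
next
  case False
  let ?m = "Poly_Mapping.single x (1::nat) + Poly_Mapping.single y 1"
  have keys: "Poly_Mapping.keys ?m = {x, y}"
    using False by (rule keys_single_plus_single)
  have "{x, y} - {x} = {y}" "{x, y} - {y} = {x}" using False by auto
  then show ?thesis
    unfolding mon_diff_def keys using False
    by (simp add: lookup_add lookup_single when_def)
qed

lemma mp_diff_single: "mp_diff (Poly_Mapping.single m c) q w = c * mon_diff m q w"
  unfolding mp_diff_def by simp

lemma mp_diff_diff: "mp_diff (F - H) q w = mp_diff F q w - mp_diff H q w"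
proof -
  let ?S = "Poly_Mapping.keys F \<union> Poly_Mapping.keys H"
  have *: "mp_diff E q w = (\<Sum>m\<in>?S. Poly_Mapping.lookup E m * mon_diff m q w)"
    if "Poly_Mapping.keys E \<subseteq> ?S" for E
    unfolding mp_diff_def using that
    by (intro sum.mono_neutral_left) (auto simp: in_keys_iff)
  have "Poly_Mapping.keys (F - H) \<subseteq> ?S"
    by (rule keys_diff)
  then show ?thesis
    by (simp add: * lookup_minus left_diff_distrib sum_subtractf)
qed

lemma prod_fun_apply: "(\<Prod>i\<in>S. F i) y = (\<Prod>i\<in>S. F i y)"
  by (induction S rule: infinite_finite_induct) auto

lemma sum_fun_apply: "(\<Sum>i\<in>S. F i) y = (\<Sum>i\<in>S. F i y)"
  by (induction S rule: infinite_finite_induct) auto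

section \<open>Two facts behind the rank of a tangent vector\<close>

lemma card_roots_rsquarefree:
  fixes p :: "'a::alg_closed_field poly"
  assumes "rsquarefree p"
  shows "card {x. poly p x = 0} = degree p"
proof -
  have p: "p \<noteq> 0" using assms unfolding rsquarefree_def by blast
  obtain A where A: "size A = degree p" "p = smult (lead_coeff p) (\<Prod>x\<in>#A. [:- x, 1:])"
    using alg_closed_imp_factorization[OF p] by blast
  have "proots p = proots (\<Prod>x\<in>#A. [:- x, 1:])"
    by (subst A(2)) (use p in simp)
  also have "\<dots> = A"
  proof (induction A)
    case (add x A)
    have "(\<Prod>x\<in>#A. [:- x, 1:]) \<noteq> 0" by (auto simp: prod_mset_zero_iff)
    then show ?case using add by (simp add: proots_mult del: mult_pCons_left)
  qed simp
  finally have "proots p = A" .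
  then have "degree p = size (proots p)" using A(1) by simp
  also have "\<dots> = (\<Sum>x | poly p x = 0. order x p)"
    using p by (simp add: size_multiset_overloaded_eq)
  also have "\<dots> = (\<Sum>x | poly p x = 0. 1)"
    by (intro sum.cong) (auto simp: rsquarefree_root_order[OF assms _ p])
  finally show ?thesis by simp
qed

lemma roots_of_unity:
  assumes "n > 0"
  shows "finite {x::'a::{alg_closed_field, field_char_0}. x ^ n = 1}"
    and "card {x::'a. x ^ n = 1} = n"
proof -
  define p :: "'a poly" where "p = monom 1 n - 1"
  have deg: "degree p = n"
    unfolding p_def diff_conv_add_uminus using assms
    by (subst degree_add_eq_left) (auto simp: degree_monom_eq)
  have roots: "{x::'a. x ^ n = 1} = {x. poly p x = 0}"
    by (auto simp: p_def poly_monom)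
  \<comment> \<open>The derivative has its only root at 0 in characteristic 0, and 0 is no root of
    \<open>p\<close>.\<close>
  have "rsquarefree p"
    unfolding rsquarefree_roots using assms
    by (auto simp: p_def pderiv_diff pderiv_monom poly_monom power_0_left)
  then show "card {x::'a. x ^ n = 1} = n" "finite {x::'a. x ^ n = 1}"
    using card_roots_rsquarefree[of p] poly_roots_finite[of p] deg assms
    unfolding roots by (auto simp: rsquarefree_def)
qed

text \<open>Multiplication by some \<open>w\<close> in \<open>R\<close> permutes \<open>R\<close>
  and scales the sum by \<open>w ^ m\<close>. There is such a \<open>w\<close> with
  \<open>w ^ m \<noteq> 1\<close>, because only \<open>m < n\<close> elements satisfy
  \<open>x ^ m = 1\<close>.\<close>

lemma sum_roots_of_unity:
  fixes R :: "'a::{alg_closed_field, field_char_0} set"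
  assumes R: "R = {x. x ^ n = 1}" and m: "0 < m" "m < n"
  shows "(\<Sum>x\<in>R. x ^ m) = 0"
proof -
  have n: "n > 0" using m by simp
  have "\<not> R \<subseteq> {x. x ^ m = 1}"
    using card_mono[OF roots_of_unity(1)[OF m(1)], of R] roots_of_unity(2)[OF m(1), where 'a = 'a]
      roots_of_unity(2)[OF n, where 'a = 'a] m R by auto
  then obtain w where w: "w \<in> R" "w ^ m \<noteq> 1" by blast
  then have w0: "w \<noteq> 0" using R n by (auto simp: power_0_left)
  have "(\<Sum>x\<in>R. x ^ m) = (\<Sum>x\<in>R. (w * x) ^ m)"
    by (rule sum.reindex_bij_witness[of _ "\<lambda>x. w * x" "\<lambda>x. x / w"])
      (use w w0 R in \<open>auto simp: power_mult_distrib power_divide\<close>)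
  also have "\<dots> = w ^ m * (\<Sum>x\<in>R. x ^ m)"
    by (simp add: power_mult_distrib sum_distrib_left)
  finally have "(1 - w ^ m) * (\<Sum>x\<in>R. x ^ m) = 0" by (simp add: algebra_simps)
  then show ?thesis using w(2) by simp
qed

text \<open>
  On polynomials of degree at most \<open>n\<close>, the coefficient of \<open>t\<close> is a combination of the values at
  the \<open>n\<close>-th roots of unity, because \<open>1\<close> is the only exponent up to \<open>n\<close> congruent to \<open>1\<close>.
\<close>

lemma sum_roots_of_unity_poly:
  fixes P :: "'a::{alg_closed_field, field_char_0} poly"
  assumes n: "n \<ge> 2" and P: "degree P \<le> n"
  shows "(\<Sum>x | x ^ n = 1. x ^ (n - 1) / of_nat n * poly P x) = coeff P 1"
proof -
  let ?R = "{x::'a. x ^ n = 1}"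
  have fin: "finite ?R" and card: "card ?R = n" using roots_of_unity[of n] n by simp_all
  have sum: "(\<Sum>x\<in>?R. x ^ (n - 1) * x ^ j) = (if j = 1 then of_nat n else 0)" if "j \<le> n" for j
  proof -
    consider "j = 0" | "j = 1" | "j \<ge> 2" by linarith
    then show ?thesis
    proof cases
      case 1
      then show ?thesis using sum_roots_of_unity[OF refl, of "n - 1" n] n by simp
    next
      case 2
      have "x ^ (n - 1) * x ^ j = 1" if "x \<in> ?R" for x
        using that n unfolding power_add[symmetric] 2 by simp
      then show ?thesis using 2 card by simp
    next
      case 3
      have "x ^ (n - 1) * x ^ j = x ^ (j - 1)" if "x \<in> ?R" for x
      proof -
        have "(n - 1) + j = n + (j - 1)" using n 3 by simp
        then have "x ^ (n - 1) * x ^ j = x ^ n * x ^ (j - 1)"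
          by (simp only: power_add[symmetric])
        then show ?thesis using that by simp
      qed
      then have "(\<Sum>x\<in>?R. x ^ (n - 1) * x ^ j) = (\<Sum>x\<in>?R. x ^ (j - 1))" by simp
      then show ?thesis using sum_roots_of_unity[OF refl, of "j - 1" n] 3 that n
        by (cases j) auto
    qed
  qed
  have "(\<Sum>x\<in>?R. x ^ (n - 1) / of_nat n * poly P x) =
      (\<Sum>x\<in>?R. \<Sum>j\<le>n. coeff P j / of_nat n * (x ^ (n - 1) * x ^ j))"
    by (simp add: poly_eq_sum_atMost[OF P] sum_distrib_left ac_simps)
  also have "\<dots> = (\<Sum>j\<le>n. coeff P j / of_nat n * (\<Sum>x\<in>?R. x ^ (n - 1) * x ^ j))"
    by (subst sum.swap) (simp add: sum_distrib_left)
  also have "\<dots> = (\<Sum>j\<le>n. if j = 1 then coeff P 1 else 0)"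
  proof (rule sum.cong)
    fix j assume "j \<in> {..n}"
    then show "coeff P j / of_nat n * (\<Sum>x\<in>?R. x ^ (n - 1) * x ^ j) = (if j = 1 then coeff P 1 else 0)"
      using n by (subst sum) auto
  qed simp
  also have "\<dots> = coeff P 1" using n by simp
  finally show ?thesis .
qed

lemma coeff_prod_linear:
  fixes a b :: "'t \<Rightarrow> 'a::comm_ring_1"
  assumes "finite S"
  shows "coeff (\<Prod>t\<in>S. [:a t, b t:]) 0 = (\<Prod>t\<in>S. a t)"
    and "coeff (\<Prod>t\<in>S. [:a t, b t:]) 1 = (\<Sum>t\<in>S. b t * (\<Prod>r\<in>S - {t}. a r))"
proof -
  have "coeff (\<Prod>t\<in>S. [:a t, b t:]) 0 = (\<Prod>t\<in>S. a t) \<and>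
      coeff (\<Prod>t\<in>S. [:a t, b t:]) 1 = (\<Sum>t\<in>S. b t * (\<Prod>r\<in>S - {t}. a r))"
    using assms
  proof induction
    case (insert x S)
    have "(\<Prod>r\<in>insert x S - {t}. a r) = a x * (\<Prod>r\<in>S - {t}. a r)" if "t \<in> S" for t
    proof -
      have "insert x S - {t} = insert x (S - {t})" using insert that by auto
      then show ?thesis using insert by simp
    qed
    then show ?case
      using insert by (simp add: sum_distrib_left ac_simps)
  qed simp
  then show "coeff (\<Prod>t\<in>S. [:a t, b t:]) 0 = (\<Prod>t\<in>S. a t)"
    "coeff (\<Prod>t\<in>S. [:a t, b t:]) 1 = (\<Sum>t\<in>S. b t * (\<Prod>r\<in>S - {t}. a r))"
    by auto
qed

text \<open>
  The substitution method: a functional that is \<open>1\<close> at \<open>v\<close> and kills one of the rank-one terms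
  removes a slot and that term. The extra multiple of \<open>v\<close> in all slots makes the induction work.
\<close>

lemma tangent_tensor_rank_ge:
  fixes D :: "'t \<Rightarrow> ('v \<Rightarrow> 'a::field) set"
  assumes "finite S" "finite J"
    and "\<And>t. t \<in> S \<Longrightarrow> \<exists>f\<in>D t. f (v t) = 1"
    and "\<And>t. t \<in> S \<Longrightarrow> \<exists>f\<in>D t. f (v t) = 0 \<and> f (u t) = 1"
    and "\<And>t j. t \<in> S \<Longrightarrow> j \<in> J \<Longrightarrow>
       (\<forall>f\<in>D t. f (v t) = 0 \<longrightarrow> f (x j t) = 0) \<or> (\<exists>f\<in>D t. f (x j t) = 0 \<and> f (v t) = 1)"
    and "\<And>f. (\<And>t. t \<in> S \<Longrightarrow> f t \<in> D t) \<Longrightarrow>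
       (\<Sum>t\<in>S. f t (u t) * (\<Prod>r\<in>S - {t}. f r (v r))) + c * (\<Prod>t\<in>S. f t (v t)) =
       (\<Sum>j\<in>J. K j * (\<Prod>t\<in>S. f t (x j t)))"
  shows "card S \<le> card J"
  using assms
proof (induction S arbitrary: J c K rule: finite_induct)
  case (insert z S)
  note eq = insert.prems(5)
  have split: "(\<Sum>t\<in>insert z S. f t (u t) * (\<Prod>r\<in>insert z S - {t}. f r (v r))) +
        c * (\<Prod>t\<in>insert z S. f t (v t)) =
      f z (u z) * (\<Prod>r\<in>S. f r (v r)) +
      f z (v z) * ((\<Sum>t\<in>S. f t (u t) * (\<Prod>r\<in>S - {t}. f r (v r))) + c * (\<Prod>t\<in>S. f t (v t)))"
    for f :: "'t \<Rightarrow> 'v \<Rightarrow> 'a" and c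
  proof -
    have "(\<Prod>r\<in>insert z S - {t}. f r (v r)) = f z (v z) * (\<Prod>r\<in>S - {t}. f r (v r))" if "t \<in> S" for t
    proof -
      have "insert z S - {t} = insert z (S - {t})" using insert that by auto
      then show ?thesis using insert by simp
    qed
    then show ?thesis using insert by (simp add: sum_distrib_left algebra_simps)
  qed
  obtain g where g: "\<And>t. t \<in> insert z S \<Longrightarrow> g t \<in> D t" "\<And>t. t \<in> insert z S \<Longrightarrow> g t (v t) = 1"
    using insert.prems(2) by metis
  \<comment> \<open>Otherwise each \<open>x j z\<close> behaves like a multiple of
    \<open>v z\<close>. A functional that is 0 at \<open>v z\<close> and 1 at \<open>u z\<close>
    then annihilates the right side, while the left side keeps the product of the
    \<open>v\<close>-values, which is 1 for \<open>g\<close>.\<close>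
  have "\<exists>j\<in>J. \<exists>f\<in>D z. f (x j z) = 0 \<and> f (v z) = 1"
  proof (rule ccontr)
    assume "\<not> ?thesis"
    then have par: "f (x j z) = 0" if "j \<in> J" "f \<in> D z" "f (v z) = 0" for j f
      using insert.prems(4)[of z j] that by blast
    obtain f where f: "f \<in> D z" "f (v z) = 0" "f (u z) = 1" using insert.prems(3)[of z] by blast
    let ?g = "g(z := f)"
    have mem: "?g t \<in> D t" if "t \<in> insert z S" for t using that f(1) g(1) by auto
    have zero: "(\<Sum>j\<in>J. K j * (\<Prod>t\<in>insert z S. ?g t (x j t))) = 0"
      using insert.hyps par[OF _ f(1,2)] by simp
    have "?g z (u z) * (\<Prod>r\<in>S. ?g r (v r)) + ?g z (v z) *
        ((\<Sum>t\<in>S. ?g t (u t) * (\<Prod>r\<in>S - {t}. ?g r (v r))) + c * (\<Prod>t\<in>S. ?g t (v t))) = 0"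
      by (rule trans[OF split[symmetric] trans[OF eq[OF mem] zero]])
    moreover have "(\<Prod>r\<in>S. ?g r (v r)) = 1"
      using g(2) insert.hyps by (intro prod.neutral) auto
    ultimately show False using f by simp
  qed
  then obtain j0 h where j0: "j0 \<in> J" "h \<in> D z" "h (x j0 z) = 0" "h (v z) = 1" by blast
  \<comment> \<open>Inserting \<open>h\<close> in slot \<open>z\<close> removes the term
    \<open>j0\<close>. As \<open>h (v z) = 1\<close>, the left side keeps its shape on
    \<open>S\<close>, with \<open>h (u z)\<close> added to the coefficient of the pure
    product.\<close>
  have "card S \<le> card (J - {j0})"
  proof (rule insert.IH[where c = "c + h (u z)" and K = "\<lambda>j. K j * h (x j z)"])
    show "finite (J - {j0})" using insert.prems(1) by simp
    fix f assume f: "\<And>t. t \<in> S \<Longrightarrow> f t \<in> D t"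
    let ?f = "f(z := h)"
    have cong: "(\<Prod>r\<in>A. ?f r (y r)) = (\<Prod>r\<in>A. f r (y r))" if "A \<subseteq> S" for A y
      using that insert.hyps by (intro prod.cong) auto
    have sum_cong': "(\<Sum>t\<in>S. ?f t (u t) * (\<Prod>r\<in>S - {t}. ?f r (v r))) =
        (\<Sum>t\<in>S. f t (u t) * (\<Prod>r\<in>S - {t}. f r (v r)))"
    proof (rule sum.cong)
      fix t assume "t \<in> S"
      then have "?f t = f t" using insert.hyps by auto
      then show "?f t (u t) * (\<Prod>r\<in>S - {t}. ?f r (v r)) = f t (u t) * (\<Prod>r\<in>S - {t}. f r (v r))"
        by (simp only: cong[OF Diff_subset])
    qed simp
    have "h (u z) * (\<Prod>r\<in>S. f r (v r)) + ((\<Sum>t\<in>S. f t (u t) * (\<Prod>r\<in>S - {t}. f r (v r))) +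
          c * (\<Prod>t\<in>S. f t (v t))) = (\<Sum>j\<in>J. K j * (\<Prod>t\<in>insert z S. ?f t (x j t)))"
    proof -
      have mem: "?f t \<in> D t" if "t \<in> insert z S" for t using that f j0(2) by auto
      have "?f z (u z) * (\<Prod>r\<in>S. ?f r (v r)) + ?f z (v z) *
          ((\<Sum>t\<in>S. ?f t (u t) * (\<Prod>r\<in>S - {t}. ?f r (v r))) + c * (\<Prod>t\<in>S. ?f t (v t))) =
        (\<Sum>j\<in>J. K j * (\<Prod>t\<in>insert z S. ?f t (x j t)))"
        by (rule trans[OF split[symmetric] eq[OF mem]])
      then show ?thesis
        unfolding sum_cong' cong[OF order_refl] by (simp only: fun_upd_same j0(4) mult_1_left)
    qed
    also have "\<dots> = (\<Sum>j\<in>J. K j * h (x j z) * (\<Prod>t\<in>S. f t (x j t)))"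
      using insert.hyps by (simp del: fun_upd_apply add: cong mult.assoc) simp
    also have "\<dots> = (\<Sum>j\<in>J - {j0}. K j * h (x j z) * (\<Prod>t\<in>S. f t (x j t)))"
      using insert.prems(1) j0(1,3) by (simp add: sum.remove[of J j0])
    finally show "(\<Sum>t\<in>S. f t (u t) * (\<Prod>r\<in>S - {t}. f r (v r))) + (c + h (u z)) * (\<Prod>t\<in>S. f t (v t)) =
        (\<Sum>j\<in>J - {j0}. K j * h (x j z) * (\<Prod>t\<in>S. f t (x j t)))"
      by (simp add: algebra_simps)
  qed (use insert.prems in auto)
  then show ?case
    using insert.hyps insert.prems(1) j0(1) by (simp add: card_Diff_singleton card_gt_0_iff Suc_le_eq)
      (metis Suc_pred card_gt_0_iff emptyE le_imp_less_Suc)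
qed simp

section \<open>Tangent vectors of the Segre-Veronese variety\<close>

locale sv_space = vector_space s
  for s :: "'a::{alg_closed_field, field_char_0} \<Rightarrow> 'v::ab_group_add \<Rightarrow> 'v" +
  fixes d :: "nat \<Rightarrow> nat" and V :: "nat \<Rightarrow> 'v set" and I :: "nat set"
  assumes finite_I: "finite I"
    and fin_dim: "\<And>i. i \<in> I \<Longrightarrow> fin_dim_subspace s (V i)"
    and d_pos: "\<And>i. i \<in> I \<Longrightarrow> d i > 0"
begin

section \<open>Arguments as families of functionals over slots\<close>

abbreviation dual where "dual i \<equiv> dual_space s (V i)"
abbreviation args where "args \<equiv> arg_space s d V I"
abbreviation ptensor where "ptensor \<equiv> power_tensor s d V I"

text \<open>Flattening both indices treats a partially symmetric tensor as a tensor in a Segre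
  product with one factor per slot.\<close>

definition slots :: "(nat \<times> nat) set" where
  "slots = (SIGMA i:I. {..<d i})"

definition entry :: "('v, 'a) arg \<Rightarrow> nat \<times> nat \<Rightarrow> 'v \<Rightarrow> 'a" where
  "entry f t = f (fst t) (snd t)"

definition upd :: "('v, 'a) arg \<Rightarrow> nat \<times> nat \<Rightarrow> ('v \<Rightarrow> 'a) \<Rightarrow> ('v, 'a) arg" where
  "upd f t g = upd_slot f (fst t) (snd t) g"

definition const_arg :: "(nat \<Rightarrow> 'v \<Rightarrow> 'a) \<Rightarrow> ('v, 'a) arg" where
  "const_arg \<gamma> = (\<lambda>i\<in>I. \<lambda>a\<in>{..<d i}. \<gamma> i)"

lemma finite_slots [simp]: "finite slots"
  unfolding slots_def using finite_I by auto

lemma slot_factor: "t \<in> slots \<Longrightarrow> fst t \<in> I"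
  unfolding slots_def by auto

lemma subspace_V: "i \<in> I \<Longrightarrow> subspace (V i)"
  using fin_dim unfolding fin_dim_subspace_def by blast

lemma entry_in_dual: "f \<in> args \<Longrightarrow> t \<in> slots \<Longrightarrow> entry f t \<in> dual (fst t)"
  unfolding arg_space_def slots_def entry_def by (auto simp: PiE_iff)

lemma upd_in_args: "f \<in> args \<Longrightarrow> t \<in> slots \<Longrightarrow> g \<in> dual (fst t) \<Longrightarrow> upd f t g \<in> args"
  unfolding arg_space_def slots_def upd_def upd_slot_def
  by (auto simp: PiE_iff extensional_def)

lemma const_arg_in_args: "(\<And>i. i \<in> I \<Longrightarrow> \<gamma> i \<in> dual i) \<Longrightarrow> const_arg \<gamma> \<in> args"
  unfolding arg_space_def const_arg_def by auto

lemma entry_upd: "entry (upd f t g) r = (if r = t then g else entry f r)"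
  unfolding entry_def upd_def upd_slot_def by (cases r; cases t) auto

lemma entry_const_arg: "t \<in> slots \<Longrightarrow> entry (const_arg \<gamma>) t = \<gamma> (fst t)"
  unfolding entry_def const_arg_def slots_def by auto

lemma args_eqI:
  assumes "f \<in> args" "g \<in> args" "\<And>t. t \<in> slots \<Longrightarrow> entry f t = entry g t"
  shows "f = g"
proof (rule ext, rule ext)
  fix i a
  show "f i a = g i a"
  proof (cases "(i, a) \<in> slots")
    case True
    then show ?thesis using assms(3)[of "(i, a)"] by (simp add: entry_def)
  next
    case False
    then show ?thesis
      using assms(1,2) unfolding arg_space_def slots_def
      by (cases "i \<in> I") (auto simp: PiE_iff extensional_def)
  qed
qed

lemma upd_entry: "upd f t (entry f t) = f"
  unfolding upd_def upd_slot_def entry_def by auto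

lemma ptensor_eq: "f \<in> args \<Longrightarrow> ptensor v f = (\<Prod>t\<in>slots. entry f t (v (fst t)))"
  unfolding power_tensor_def slots_def entry_def
  by (simp add: prod.Sigma finite_I case_prod_beta)

lemma prod_slots_remove:
  "t \<in> slots \<Longrightarrow> (\<Prod>r\<in>slots. h r) = h t * (\<Prod>r\<in>slots - {t}. h r)"
  by (rule prod.remove) auto

lemma ptensor_upd:
  assumes "f \<in> args" "t \<in> slots" "g \<in> dual (fst t)"
  shows "ptensor v (upd f t g) = g (v (fst t)) * (\<Prod>r\<in>slots - {t}. entry f r (v (fst r)))"
proof -
  have "(\<Prod>r\<in>slots - {t}. entry (upd f t g) r (v (fst r))) = (\<Prod>r\<in>slots - {t}. entry f r (v (fst r)))"
    by (intro prod.cong) (auto simp: entry_upd)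
  then show ?thesis
    using ptensor_eq[OF upd_in_args[OF assms], of v]
    by (subst (asm) prod_slots_remove[OF assms(2)]) (simp add: entry_upd)
qed

text \<open>
  The shape of a tangent vector at the point of \<open>v\<close>, in a form that refers to the tensor \<open>w\<close> only
  through its values near the argument \<open>g\<close> (normalised by \<open>g\<^sub>i(v\<^sub>i) = 1\<close>), so that it passes to limits.
\<close>

definition tangent_form :: "(nat \<Rightarrow> 'v) \<Rightarrow> ('v, 'a) arg \<Rightarrow> ('v, 'a) tensor \<Rightarrow> bool" where
  "tangent_form v g w \<longleftrightarrow> (\<forall>f\<in>args.
     w f = (\<Prod>t\<in>slots. entry f t (v (fst t))) * w g +
       (\<Sum>t\<in>slots. (\<Prod>r\<in>slots - {t}. entry f r (v (fst r))) *
          (w (upd g t (entry f t)) - entry f t (v (fst t)) * w g)))"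

text \<open>The identity \<open>quad\<close> expresses \<open>w f\<close> by the value at
  \<open>f\<close> with slot \<open>t\<close> reset to \<open>\<gamma>\<close> and by a value of
  \<open>w\<close> next to the base argument. Resetting the slots one after another ends at the base
  argument itself, so the induction runs over the slots in which \<open>f\<close> may differ from
  it.\<close>

lemma tangent_formI:
  assumes \<gamma>: "\<And>i. i \<in> I \<Longrightarrow> \<gamma> i \<in> dual i" "\<And>i. i \<in> I \<Longrightarrow> \<gamma> i (v i) = 1"
    and quad: "\<And>f t. f \<in> args \<Longrightarrow> t \<in> slots \<Longrightarrow>
      w f + (\<Prod>r\<in>slots. entry f r (v (fst r))) * w (const_arg \<gamma>) =
      entry f t (v (fst t)) * w (upd f t (\<gamma> (fst t))) +
      (\<Prod>r\<in>slots - {t}. entry f r (v (fst r))) * w (upd (const_arg \<gamma>) t (entry f t))"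
  shows "tangent_form v (const_arg \<gamma>) w"
proof -
  define g where "g = const_arg \<gamma>"
  have g: "g \<in> args" unfolding g_def using \<gamma>(1) by (rule const_arg_in_args)
  \<comment> \<open>The contribution of the derivative in slot \<open>t\<close>; it is 0 as soon as
    this slot carries \<open>\<gamma>\<close>, by the normalisation at \<open>v\<close>.\<close>
  define C where "C f t = w (upd g t (entry f t)) - entry f t (v (fst t)) * w g" for f t
  have *: "w f = (\<Prod>t\<in>slots. entry f t (v (fst t))) * w g +
       (\<Sum>t\<in>slots. (\<Prod>r\<in>slots - {t}. entry f r (v (fst r))) * C f t)"
    if "finite S" "S \<subseteq> slots" "f \<in> args" "\<And>t. t \<in> slots - S \<Longrightarrow> entry f t = entry g t" for S f
    using that
  proof (induction S arbitrary: f)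
    case empty
    then have "f = g" using g by (intro args_eqI) auto
    moreover have "C g t = 0" if "t \<in> slots" for t
      using that \<gamma>(2)[OF slot_factor[OF that]] upd_entry[of g t] slot_factor
      unfolding C_def by (simp add: g_def entry_const_arg)
    moreover have "(\<Prod>t\<in>slots. entry g t (v (fst t))) = 1"
      by (rule prod.neutral) (use \<gamma>(2) slot_factor in \<open>auto simp: g_def entry_const_arg\<close>)
    ultimately show ?case by simp
  next
    case (insert s S)
    have s: "s \<in> slots" using insert by auto
    define F where "F t = entry f t (v (fst t))" for t
    define f' where "f' = upd f s (\<gamma> (fst s))"
    have f': "f' \<in> args"
      unfolding f'_def by (rule upd_in_args[OF insert.prems(2) s \<gamma>(1)[OF slot_factor[OF s]]])
    have ent: "entry f' t = (if t = s then \<gamma> (fst s) else entry f t)" for t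
      unfolding f'_def by (rule entry_upd)
    have "w f' = (\<Prod>t\<in>slots. entry f' t (v (fst t))) * w g +
       (\<Sum>t\<in>slots. (\<Prod>r\<in>slots - {t}. entry f' r (v (fst r))) * C f' t)"
      by (rule insert.IH)
        (use insert.prems f' s in \<open>auto simp: ent g_def entry_const_arg\<close>)
    also have "(\<Prod>t\<in>slots. entry f' t (v (fst t))) = (\<Prod>t\<in>slots - {s}. F t)"
    proof -
      have "(\<Prod>r\<in>slots - {s}. entry f' r (v (fst r))) = (\<Prod>r\<in>slots - {s}. F r)"
        by (intro prod.cong) (auto simp: ent F_def)
      then show ?thesis
        using \<gamma>(2)[OF slot_factor[OF s]] by (simp add: prod_slots_remove[OF s] ent)
    qed
    also have "(\<Sum>t\<in>slots. (\<Prod>r\<in>slots - {t}. entry f' r (v (fst r))) * C f' t) =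
        (\<Sum>t\<in>slots - {s}. (\<Prod>r\<in>slots - {t} - {s}. F r) * C f t)"
    proof -
      have "C f' s = 0"
        using \<gamma>(2)[OF slot_factor[OF s]] upd_entry[of g s] slot_factor[OF s] s
        unfolding C_def by (simp add: ent g_def entry_const_arg)
      then have "(\<Sum>t\<in>slots. (\<Prod>r\<in>slots - {t}. entry f' r (v (fst r))) * C f' t) =
         (\<Sum>t\<in>slots - {s}. (\<Prod>r\<in>slots - {t}. entry f' r (v (fst r))) * C f' t)"
        by (simp add: sum.remove[OF finite_slots s])
      also have "\<dots> = (\<Sum>t\<in>slots - {s}. (\<Prod>r\<in>slots - {t} - {s}. F r) * C f t)"
      proof (rule sum.cong)
        fix t assume t: "t \<in> slots - {s}"
        have "(\<Prod>r\<in>slots - {t}. entry f' r (v (fst r))) =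
            entry f' s (v (fst s)) * (\<Prod>r\<in>slots - {t} - {s}. entry f' r (v (fst r)))"
          using t s by (intro prod.remove) auto
        also have "(\<Prod>r\<in>slots - {t} - {s}. entry f' r (v (fst r))) = (\<Prod>r\<in>slots - {t} - {s}. F r)"
          by (intro prod.cong) (auto simp: ent F_def)
        finally show "(\<Prod>r\<in>slots - {t}. entry f' r (v (fst r))) * C f' t =
            (\<Prod>r\<in>slots - {t} - {s}. F r) * C f t"
          using t \<gamma>(2)[OF slot_factor[OF s]] by (simp add: ent C_def)
      qed simp
      finally show ?thesis .
    qed
    finally have wf': "w f' = (\<Prod>t\<in>slots - {s}. F t) * w g +
        (\<Sum>t\<in>slots - {s}. (\<Prod>r\<in>slots - {t} - {s}. F r) * C f t)" .
    have mult: "F s * (\<Prod>r\<in>slots - {t} - {s}. F r) = (\<Prod>r\<in>slots - {t}. F r)"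
      if "t \<in> slots - {s}" for t
      by (rule prod.remove[symmetric]) (use that s in auto)
    have "w f = F s * w f' + (\<Prod>r\<in>slots - {s}. F r) * (w (upd g s (entry f s)) - F s * w g)"
      using quad[OF insert.prems(2) s]
      by (simp add: g_def[symmetric] f'_def[symmetric] F_def[symmetric] prod_slots_remove[OF s]
          algebra_simps)
    also have "F s * w f' = (\<Prod>t\<in>slots. F t) * w g +
        (\<Sum>t\<in>slots - {s}. (\<Prod>r\<in>slots - {t}. F r) * C f t)"
      unfolding wf'
      by (simp add: distrib_left sum_distrib_left mult.assoc[symmetric] mult
          prod_slots_remove[OF s, symmetric])
    also have "w (upd g s (entry f s)) - F s * w g = C f s"
      by (simp add: C_def F_def)
    finally show ?case
      by (simp add: sum.remove[OF finite_slots s] F_def)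
  qed
  show ?thesis
    unfolding tangent_form_def g_def[symmetric] using *[of slots] by (simp add: C_def)
qed

definition tangents :: "('v, 'a) tensor set" where
  "tangents = {w. \<exists>v. (\<forall>i\<in>I. v i \<in> V i \<and> v i \<noteq> 0) \<and>
     (\<forall>v' \<gamma>. (\<forall>i\<in>I. (\<exists>c. c \<noteq> 0 \<and> v' i = s c (v i)) \<and> \<gamma> i \<in> dual i \<and> \<gamma> i (v' i) = 1) \<longrightarrow>
        tangent_form v' (const_arg \<gamma>) w)}"

lemma tangents_cone: "w \<in> tangents \<Longrightarrow> (\<lambda>f. c * w f) \<in> tangents"
proof -
  have "tangent_form v g (\<lambda>f. c * w f)" if "tangent_form v g w" for v g
    unfolding tangent_form_def
  proof
    fix f assume "f \<in> args"
    then have "w f = (\<Prod>t\<in>slots. entry f t (v (fst t))) * w g +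
       (\<Sum>t\<in>slots. (\<Prod>r\<in>slots - {t}. entry f r (v (fst r))) *
          (w (upd g t (entry f t)) - entry f t (v (fst t)) * w g))"
      using that unfolding tangent_form_def by blast
    then have "c * w f = c * ((\<Prod>t\<in>slots. entry f t (v (fst t))) * w g) +
       (\<Sum>t\<in>slots. c * ((\<Prod>r\<in>slots - {t}. entry f r (v (fst r))) *
          (w (upd g t (entry f t)) - entry f t (v (fst t)) * w g)))"
      by (simp only: distrib_left sum_distrib_left)
    also have "\<dots> = (\<Prod>t\<in>slots. entry f t (v (fst t))) * (c * w g) +
       (\<Sum>t\<in>slots. (\<Prod>r\<in>slots - {t}. entry f r (v (fst r))) *
          (c * w (upd g t (entry f t)) - entry f t (v (fst t)) * (c * w g)))"
      by (intro arg_cong2[where f = "(+)"] sum.cong) (simp_all add: algebra_simps)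
    finally show "c * w f = (\<Prod>t\<in>slots. entry f t (v (fst t))) * (c * w g) +
       (\<Sum>t\<in>slots. (\<Prod>r\<in>slots - {t}. entry f r (v (fst r))) *
          (c * w (upd g t (entry f t)) - entry f t (v (fst t)) * (c * w g)))" .
  qed
  note form = this
  assume "w \<in> tangents"
  then obtain v where v: "\<forall>i\<in>I. v i \<in> V i \<and> v i \<noteq> 0"
    "\<And>v' \<gamma>. (\<forall>i\<in>I. (\<exists>c. c \<noteq> 0 \<and> v' i = s c (v i)) \<and> \<gamma> i \<in> dual i \<and> \<gamma> i (v' i) = 1) \<Longrightarrow>
        tangent_form v' (const_arg \<gamma>) w"
    unfolding tangents_def mem_Collect_eq by metis
  show "(\<lambda>f. c * w f) \<in> tangents"
    unfolding tangents_def mem_Collect_eq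
    by (intro exI[of _ v] conjI v(1) allI impI form v(2))
qed

section \<open>Quadratic equations and the passage to the closure\<close>

definition exchange_quadric :: "('v, 'a) arg \<Rightarrow> ('v, 'a) arg \<Rightarrow> nat \<times> nat \<Rightarrow> (('v, 'a) arg, 'a) mpolynomial" where
  "exchange_quadric f g t =
     Poly_Mapping.single (Poly_Mapping.single f 1 + Poly_Mapping.single g 1) 1 -
     Poly_Mapping.single (Poly_Mapping.single (upd f t (entry g t)) 1 +
       Poly_Mapping.single (upd g t (entry f t)) 1) 1"

text \<open>These are 2 by 2 minors of the flattening that separates slot \<open>t\<close> from all
  other slots, and a power tensor has rank at most one in this flattening.\<close>

lemma exchange_quadric_in_ideal:
  assumes f: "f \<in> args" and g: "g \<in> args" and t: "t \<in> slots"
  shows "exchange_quadric f g t \<in> homogeneous_ideal (segre_veronese s d V I)"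
proof -
  have "(\<Sum>x\<in>Poly_Mapping.keys m. Poly_Mapping.lookup m x) = 2"
    if "m = Poly_Mapping.single x 1 + Poly_Mapping.single y 1"
    for m :: "('v, 'a) arg \<Rightarrow>\<^sub>0 nat" and x y
  proof (cases "x = y")
    case True
    then show ?thesis using that by (simp add: single_add[symmetric])
  next
    case False
    then have "Poly_Mapping.keys m = {x, y}"
      using that keys_single_plus_single by metis
    then show ?thesis using False that by (simp add: lookup_add lookup_single when_def)
  qed
  moreover have "Poly_Mapping.keys (exchange_quadric f g t) \<subseteq>
      {Poly_Mapping.single f 1 + Poly_Mapping.single g 1, Poly_Mapping.single (upd f t (entry g t)) 1 +
       Poly_Mapping.single (upd g t (entry f t)) 1}"
    unfolding exchange_quadric_def by (rule order_trans[OF keys_diff]) auto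
  ultimately have "mp_homogeneous (exchange_quadric f g t)"
    unfolding mp_homogeneous_def by (intro exI[of _ 2]) blast
  moreover have "mp_eval (exchange_quadric f g t) p = 0"
    if Pp: "P \<in> segre_veronese s d V I" "p \<in> P" for P p
  proof -
    obtain v c where p: "p = (\<lambda>f. c * ptensor v f)"
      using Pp unfolding segre_veronese_def proj_class_def by blast
    have "ptensor v f = entry f t (v (fst t)) * (\<Prod>r\<in>slots - {t}. entry f r (v (fst r)))"
      "ptensor v g = entry g t (v (fst t)) * (\<Prod>r\<in>slots - {t}. entry g r (v (fst r)))"
      using f g by (simp_all add: ptensor_eq prod_slots_remove[OF t])
    then have "p f * p g = p (upd f t (entry g t)) * p (upd g t (entry f t))"
      using f g t by (simp add: p ptensor_upd entry_in_dual)
    then show ?thesis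
      by (simp add: exchange_quadric_def mp_eval_diff mp_eval_single mon_eval_add mon_eval_single)
  qed
  ultimately show ?thesis unfolding homogeneous_ideal_def by blast
qed

text \<open>The differential of the quadric of \<open>f\<close> and a normalised argument is the
  linear identity required by \<open>tangent_formI\<close>, since the power of \<open>v'\<close>
  takes the value 1 at that argument.\<close>

lemma tangent_space_subset_tangents:
  assumes Q: "Q \<in> segre_veronese s d V I"
    and P: "P \<in> proj_tangent_space W (segre_veronese s d V I) Q" and w: "w \<in> P"
  shows "w \<in> tangents"
proof -
  obtain v where v: "\<And>i. i \<in> I \<Longrightarrow> v i \<in> V i \<and> v i \<noteq> 0" and Qv: "Q = proj_class (ptensor v)"
    using Q unfolding segre_veronese_def by blast
  have "tangent_form v' (const_arg \<gamma>) w"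
    if vg: "\<forall>i\<in>I. (\<exists>c. c \<noteq> 0 \<and> v' i = s c (v i)) \<and> \<gamma> i \<in> dual i \<and> \<gamma> i (v' i) = 1" for v' \<gamma>
  proof -
    obtain c where c: "\<And>i. i \<in> I \<Longrightarrow> c i \<noteq> 0 \<and> v' i = s (c i) (v i)"
      using vg by metis
    have entry_v': "entry f t (v' (fst t)) = c (fst t) * entry f t (v (fst t))"
      if "f \<in> args" "t \<in> slots" for f t
      using c v slot_factor[OF that(2)] dual_space_scale[OF entry_in_dual[OF that]] by simp
    \<comment> \<open>Rescaling the \<open>v i\<close> rescales the power tensor by a nonzero
      factor, so the equations may be differentiated at the representative given by
      \<open>v'\<close>.\<close>
    have "ptensor v' = (\<lambda>f. (\<Prod>t\<in>slots. c (fst t)) * ptensor v f)"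
    proof
      fix f
      show "ptensor v' f = (\<Prod>t\<in>slots. c (fst t)) * ptensor v f"
        by (cases "f \<in> args")
          (simp_all add: ptensor_eq entry_v' prod.distrib, simp_all add: power_tensor_def)
    qed
    moreover have "(\<Prod>t\<in>slots. c (fst t)) \<noteq> 0"
      using c slot_factor by auto
    ultimately have q: "ptensor v' \<in> Q"
      unfolding Qv proj_class_def by blast
    have \<gamma>: "\<gamma> i \<in> dual i" "\<gamma> i (v' i) = 1" if "i \<in> I" for i using vg that by auto
    have g: "const_arg \<gamma> \<in> args" by (rule const_arg_in_args) (rule \<gamma>)
    show ?thesis
    proof (rule tangent_formI[OF \<gamma>])
      fix f t assume f: "f \<in> args" and t: "t \<in> slots"
      let ?g = "const_arg \<gamma>"
      have "mp_diff (exchange_quadric f ?g t) (ptensor v') w = 0"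
        using P w q exchange_quadric_in_ideal[OF f g t] unfolding proj_tangent_space_def by blast
      then have "ptensor v' f * w ?g + ptensor v' ?g * w f =
          ptensor v' (upd f t (entry ?g t)) * w (upd ?g t (entry f t)) +
          ptensor v' (upd ?g t (entry f t)) * w (upd f t (entry ?g t))"
        unfolding exchange_quadric_def mp_diff_diff mp_diff_single mon_diff_two
        by (simp add: mult.commute)
      moreover have one: "entry ?g r (v' (fst r)) = 1" if "r \<in> slots" for r
        using that \<gamma>(2) slot_factor by (simp add: entry_const_arg)
      then have "ptensor v' ?g = 1" "(\<Prod>r\<in>slots - {t}. entry ?g r (v' (fst r))) = 1"
        using g by (simp_all add: ptensor_eq)
      ultimately show "w f + (\<Prod>r\<in>slots. entry f r (v' (fst r))) * w ?g =
          entry f t (v' (fst t)) * w (upd f t (\<gamma> (fst t))) +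
          (\<Prod>r\<in>slots - {t}. entry f r (v' (fst r))) * w (upd ?g t (entry f t))"
        using f t g \<gamma>(2)[OF slot_factor[OF t]] \<gamma>(1)[OF slot_factor[OF t]] entry_in_dual[OF f t]
        by (simp add: ptensor_upd ptensor_eq[OF f] entry_const_arg algebra_simps)
    qed
  qed
  then show ?thesis unfolding tangents_def using v by blast
qed

text \<open>For homogeneous \<open>H\<close> the zero set is closed and contains all tangent spaces,
  hence their closure. The general case follows because \<open>tangents\<close> is a cone.\<close>

lemma tangential_variety_eval_zero:
  assumes p: "proj_class p \<in> tangential_variety W (segre_veronese s d V I)"
    and F: "\<forall>w\<in>tangents. mp_eval F w = 0"
  shows "mp_eval F p = 0"
proof (rule mp_eval_zero_of_homogeneous[OF tangents_cone _ bspec[OF F]])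
  fix H :: "(('v, 'a) arg, 'a) mpolynomial"
  assume H: "mp_homogeneous H" "\<forall>w\<in>tangents. mp_eval H w = 0"
  have "proj_zariski_closed W (proj_zeros W {H})"
    unfolding proj_zariski_closed_def using H(1) by blast
  moreover have "(\<Union>Q\<in>segre_veronese s d V I. proj_tangent_space W (segre_veronese s d V I) Q)
      \<subseteq> proj_zeros W {H}"
    using H(2) tangent_space_subset_tangents
    unfolding proj_zeros_def by (auto simp: proj_tangent_space_def)
  ultimately have "proj_class p \<in> proj_zeros W {H}"
    using p unfolding tangential_variety_def proj_zariski_closure_def by blast
  moreover have "p \<in> proj_class p"
    unfolding proj_class_def by (auto intro!: exI[of _ 1])
  ultimately show "mp_eval H p = 0"
    unfolding proj_zeros_def by blast
qed

text \<open>
  Dividing \<open>v\<^sub>i\<close> by a coordinate of least valuation makes all quantities in the tangent form converge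
  under the generalized limit, and the limit vector is nonzero.
\<close>

lemma tangent_form_limit:
  assumes p: "\<And>F. \<forall>w\<in>tangents. mp_eval F w = 0 \<Longrightarrow> mp_eval F p = 0"
  obtains v \<gamma> where "\<And>i. i \<in> I \<Longrightarrow> v i \<in> V i" "\<And>i. i \<in> I \<Longrightarrow> \<gamma> i \<in> dual i"
    "\<And>i. i \<in> I \<Longrightarrow> \<gamma> i (v i) = 1" "tangent_form v (const_arg \<gamma>) p"
proof -
  obtain G where G: "maximal_partial_hom G"
    and poly_mem: "\<forall>F x. (\<forall>w\<in>tangents. x w = mp_eval F w) \<longrightarrow> (x, mp_eval F p) \<in> G"
    by (rule generalized_limit_exists[OF p])
  interpret G: maximal_partial_hom G by (rule G)
  have coord: "(\<lambda>w. w f, p f) \<in> G" for f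
    using poly_mem[rule_format, of "\<lambda>w. w f" "Poly_Mapping.single (Poly_Mapping.single f 1) 1"]
    by (simp add: mp_eval_single mon_eval_single)
  have const: "(x, c) \<in> G" if "\<And>y. y \<in> tangents \<Longrightarrow> x y = c" for x c
    using poly_mem[rule_format, of x "Poly_Mapping.single 0 c"] that by (simp add: mp_eval_single)

  have "\<forall>w\<in>tangents. \<exists>v. (\<forall>i\<in>I. v i \<in> V i \<and> v i \<noteq> 0) \<and>
     (\<forall>v' \<gamma>. (\<forall>i\<in>I. (\<exists>c. c \<noteq> 0 \<and> v' i = s c (v i)) \<and> \<gamma> i \<in> dual i \<and> \<gamma> i (v' i) = 1) \<longrightarrow>
        tangent_form v' (const_arg \<gamma>) w)"
    unfolding tangents_def by blast
  then obtain v0 where v0: "\<forall>w\<in>tangents. (\<forall>i\<in>I. v0 w i \<in> V i \<and> v0 w i \<noteq> 0) \<and>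
     (\<forall>v' \<gamma>. (\<forall>i\<in>I. (\<exists>c. c \<noteq> 0 \<and> v' i = s c (v0 w i)) \<and> \<gamma> i \<in> dual i \<and> \<gamma> i (v' i) = 1) \<longrightarrow>
        tangent_form v' (const_arg \<gamma>) w)"
    by (rule bchoice[THEN exE])
  \<comment> \<open>The value 0 outside \<open>tangents\<close> keeps \<open>vv w i\<close> in
    \<open>V i\<close> for every \<open>w\<close>, so that expansion in the basis is valid
    throughout.\<close>
  define vv where "vv w = (if w \<in> tangents then v0 w else (\<lambda>_. 0))" for w
  have vv_V: "vv w i \<in> V i" if "i \<in> I" for w i
    using v0 subspace_0[OF subspace_V[OF that]] that by (auto simp: vv_def)
  have vv_nz: "vv w i \<noteq> 0" if "w \<in> tangents" "i \<in> I" for w i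
    using v0 that by (auto simp: vv_def)
  have vv_form: "tangent_form v' (const_arg \<gamma>) w"
    if "w \<in> tangents" "\<And>i. i \<in> I \<Longrightarrow> (\<exists>c. c \<noteq> 0 \<and> v' i = s c (vv w i)) \<and> \<gamma> i \<in> dual i \<and> \<gamma> i (v' i) = 1"
    for w v' \<gamma>
  proof -
    have "\<forall>i\<in>I. (\<exists>c. c \<noteq> 0 \<and> v' i = s c (v0 w i)) \<and> \<gamma> i \<in> dual i \<and> \<gamma> i (v' i) = 1"
      using that by (simp add: vv_def)
    then show ?thesis
      using bspec[OF v0 that(1), THEN conjunct2, THEN spec, THEN spec, THEN mp] by blast
  qed

  have "\<forall>i\<in>I. \<exists>Be. finite (fst Be) \<and> fst Be \<subseteq> V i \<and> (\<forall>b. snd Be b \<in> dual i) \<and>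
      (\<forall>x\<in>V i. (\<Sum>b\<in>fst Be. s (snd Be b x) b) = x)"
  proof
    fix i assume i: "i \<in> I"
    obtain B e where "finite B" "B \<subseteq> V i" "\<And>b. e b \<in> dual i"
      "\<And>x. x \<in> V i \<Longrightarrow> (\<Sum>b\<in>B. s (e b x) b) = x"
      using dual_basis_exists[OF fin_dim[OF i]] by metis
    then show "\<exists>Be. finite (fst Be) \<and> fst Be \<subseteq> V i \<and> (\<forall>b. snd Be b \<in> dual i) \<and>
      (\<forall>x\<in>V i. (\<Sum>b\<in>fst Be. s (snd Be b x) b) = x)"
      by (intro exI[of _ "(B, e)"]) auto
  qed
  then obtain Be where Be: "\<forall>i\<in>I. finite (fst (Be i)) \<and> fst (Be i) \<subseteq> V i \<and>
      (\<forall>b. snd (Be i) b \<in> dual i) \<and> (\<forall>x\<in>V i. (\<Sum>b\<in>fst (Be i). s (snd (Be i) b x) b) = x)"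
    by (rule bchoice[THEN exE])
  define B e where "B i = fst (Be i)" and "e i = snd (Be i)" for i
  have B: "finite (B i)" "B i \<subseteq> V i" "e i b \<in> dual i"
    and repr: "x \<in> V i \<Longrightarrow> (\<Sum>b\<in>B i. s (e i b x) b) = x" if "i \<in> I" for i b x
    using Be that unfolding B_def e_def by auto
  define c where "c i b w = e i b (vv w i)" for i b w

  have "\<exists>l\<in>B i. (\<lambda>w. of_bool (c i l w \<noteq> 0), 1) \<in> G \<and> (\<forall>b\<in>B i. (\<lambda>w. c i b w / c i l w) \<in> Domain G)"
    if i: "i \<in> I" for i
  proof -
    have "\<exists>b\<in>B i. c i b w \<noteq> 0" if "w \<in> tangents" for w
    proof (rule ccontr)
      assume "\<not> ?thesis"
      then have "vv w i = 0" using repr[OF i vv_V[OF i, of w]] by (simp add: c_def)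
      then show False using vv_nz that i by blast
    qed
    then have "(\<lambda>w. of_bool (\<exists>b\<in>B i. c i b w \<noteq> 0), 1) \<in> G"
      by (intro const) auto
    then obtain l where "l \<in> B i" "(\<lambda>w. of_bool (c i l w \<noteq> 0), 1) \<in> G"
      "\<And>b. b \<in> B i \<Longrightarrow> (\<lambda>w. c i b w / c i l w) \<in> Domain G"
      by (rule pivot_exists[OF G B(1)[OF i]]) blast
    then show ?thesis by blast
  qed
  then have "\<forall>i\<in>I. \<exists>l. l \<in> B i \<and> (\<lambda>w. of_bool (c i l w \<noteq> 0), 1) \<in> G \<and>
      (\<forall>b\<in>B i. (\<lambda>w. c i b w / c i l w) \<in> Domain G)"
    by blast
  then obtain l where l': "\<forall>i\<in>I. l i \<in> B i \<and> (\<lambda>w. of_bool (c i (l i) w \<noteq> 0), 1) \<in> G \<and>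
      (\<forall>b\<in>B i. (\<lambda>w. c i b w / c i (l i) w) \<in> Domain G)"
    by (rule bchoice[THEN exE])
  then have l: "l i \<in> B i" "(\<lambda>w. of_bool (c i (l i) w \<noteq> 0), 1) \<in> G" if "i \<in> I" for i
    using that by auto
  define a where "a i b = (SOME a. (\<lambda>w. c i b w / c i (l i) w, a) \<in> G)" for i b
  have a: "(\<lambda>w. c i b w / c i (l i) w, a i b) \<in> G" if "i \<in> I" "b \<in> B i" for i b
    unfolding a_def by (rule someI_ex) (use l' that in blast)
  define v where "v i = (\<Sum>b\<in>B i. s (a i b) b)" for i
  define \<gamma> where "\<gamma> i = e i (l i)" for i
  have v_V: "v i \<in> V i" if "i \<in> I" for i
    unfolding v_def using B(2)[OF that]
    by (intro subspace_sum subspace_scale subspace_V that) auto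
  have \<gamma>: "\<gamma> i \<in> dual i" if "i \<in> I" for i
    unfolding \<gamma>_def by (rule B(3)[OF that])
  \<comment> \<open>Expanded in the basis, the quotient is a constant linear combination of the
    quotients \<open>c i b w / c i (l i) w\<close>, all of which have limits.\<close>
  have lim: "(\<lambda>w. f (vv w i) / c i (l i) w, f (v i)) \<in> G" if i: "i \<in> I" and f: "f \<in> dual i" for f i
  proof -
    have "(\<Sum>b\<in>B i. (\<lambda>w. c i b w / c i (l i) w) * (\<lambda>_. f b), \<Sum>b\<in>B i. a i b * f b) \<in> G"
      using i by (intro G.sum_mem G.mult_mem a const) auto
    moreover have "(\<Sum>b\<in>B i. a i b * f b) = f (v i)"
      unfolding v_def using B(2)[OF i]
      by (intro dual_space_sum_scale[OF fin_dim[OF i] f, symmetric]) auto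
    moreover have "(\<Sum>b\<in>B i. (\<lambda>w. c i b w / c i (l i) w) * (\<lambda>_. f b)) =
        (\<lambda>w. f (vv w i) / c i (l i) w)"
    proof
      fix w
      have "f (vv w i) = f (\<Sum>b\<in>B i. s (c i b w) b)"
        using repr[OF i vv_V[OF i, of w]] by (simp add: c_def)
      also have "\<dots> = (\<Sum>b\<in>B i. c i b w * f b)"
        using B(2)[OF i] by (intro dual_space_sum_scale[OF fin_dim[OF i] f]) auto
      finally show "(\<Sum>b\<in>B i. (\<lambda>w. c i b w / c i (l i) w) * (\<lambda>_. f b)) w = f (vv w i) / c i (l i) w"
        by (simp add: sum_fun_apply sum_divide_distrib)
    qed
    ultimately show ?thesis by simp
  qed
  \<comment> \<open>The pivot coordinate divided by itself is an indicator of limit 1; this is what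
    keeps the limit vector away from 0.\<close>
  have \<gamma>v: "\<gamma> i (v i) = 1" if "i \<in> I" for i
  proof -
    have "(\<lambda>w. \<gamma> i (vv w i) / c i (l i) w) = (\<lambda>w. of_bool (c i (l i) w \<noteq> 0))"
      by (auto simp: \<gamma>_def c_def)
    then show ?thesis
      using lim[OF that \<gamma>[OF that]] l(2)[OF that] G.unique by metis
  qed
  have "tangent_form v (const_arg \<gamma>) p"
    unfolding tangent_form_def
  proof
    fix f assume f: "f \<in> args"
    let ?g = "const_arg \<gamma>"
    define N where "N t w = entry f t (vv w (fst t)) / c (fst t) (l (fst t)) w" for t w
    have N: "(N t, entry f t (v (fst t))) \<in> G" if "t \<in> slots" for t
      unfolding N_def using that f by (intro lim slot_factor entry_in_dual)
    define \<rho> where "\<rho> = (\<Prod>t\<in>slots. N t) * (\<lambda>w. w ?g) + (\<Sum>t\<in>slots. (\<Prod>r\<in>slots - {t}. N r) *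
          ((\<lambda>w. w (upd ?g t (entry f t))) - N t * (\<lambda>w. w ?g)))"
    have \<rho>: "(\<rho>, (\<Prod>t\<in>slots. entry f t (v (fst t))) * p ?g +
       (\<Sum>t\<in>slots. (\<Prod>r\<in>slots - {t}. entry f r (v (fst r))) *
          (p (upd ?g t (entry f t)) - entry f t (v (fst t)) * p ?g))) \<in> G"
      unfolding \<rho>_def
      by (intro G.add_mem G.mult_mem G.prod_mem G.sum_mem G.diff_mem N coord) auto
    \<comment> \<open>Marks the tangent vectors at which all pivot coordinates are nonzero. There
      \<open>vv w\<close> can be rescaled to pivot coordinates 1, and the tangent form of
      \<open>w\<close> gives \<open>\<rho> w = w f\<close>.\<close>
    define E :: "('v, 'a) tensor \<Rightarrow> 'a" where "E = (\<lambda>w. of_bool (w \<in> tangents)) * (\<Prod>i\<in>I. (\<lambda>w. of_bool (c i (l i) w \<noteq> 0)))"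
    have "(E, 1 * (\<Prod>i\<in>I. 1)) \<in> G"
      unfolding E_def by (intro G.mult_mem G.prod_mem const l(2)) auto
    then have E: "(E, 1) \<in> G" by simp
    have "\<rho> w = w f" if "E w \<noteq> 0" for w
    proof -
      have w: "w \<in> tangents" and nz: "\<And>i. i \<in> I \<Longrightarrow> c i (l i) w \<noteq> 0"
        using that finite_I by (auto simp: E_def prod_fun_apply split: if_splits)
      define v' where "v' i = s (inverse (c i (l i) w)) (vv w i)" for i
      have "tangent_form v' ?g w"
      proof (rule vv_form[OF w], intro conjI)
        fix i assume i: "i \<in> I"
        show "\<exists>c. c \<noteq> 0 \<and> v' i = s c (vv w i)" using nz[OF i]
          by (intro exI[of _ "inverse (c i (l i) w)"]) (simp add: v'_def)
        show "\<gamma> i \<in> dual i" using \<gamma> i .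
        show "\<gamma> i (v' i) = 1"
          using nz[OF i] dual_space_scale[OF \<gamma>[OF i] vv_V[OF i, of w]]
          by (simp add: v'_def \<gamma>_def c_def)
      qed
      moreover have "entry f t (v' (fst t)) = N t w" if "t \<in> slots" for t
        using dual_space_scale[OF entry_in_dual[OF f that] vv_V[OF slot_factor[OF that], of w]]
        by (simp add: v'_def N_def divide_inverse mult.commute)
      ultimately show ?thesis
        using f unfolding tangent_form_def \<rho>_def by (simp add: prod_fun_apply sum_fun_apply)
    qed
    then have "\<rho> * E = (\<lambda>w. w f) * E"
      by (auto simp: fun_eq_iff)
    then have "(\<lambda>w. w f, (\<Prod>t\<in>slots. entry f t (v (fst t))) * p ?g +
       (\<Sum>t\<in>slots. (\<Prod>r\<in>slots - {t}. entry f r (v (fst r))) *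
          (p (upd ?g t (entry f t)) - entry f t (v (fst t)) * p ?g))) \<in> G"
      using G.eventually_eq_mem[OF E _ \<rho>] by blast
    then show "p f = (\<Prod>t\<in>slots. entry f t (v (fst t))) * p ?g +
       (\<Sum>t\<in>slots. (\<Prod>r\<in>slots - {t}. entry f r (v (fst r))) *
          (p (upd ?g t (entry f t)) - entry f t (v (fst t)) * p ?g))"
      using coord G.unique by blast
  qed
  then show ?thesis using that v_V \<gamma> \<gamma>v by blast
qed

section \<open>Explicit tangent vectors\<close>

definition tangent :: "(nat \<Rightarrow> 'v) \<Rightarrow> (nat \<Rightarrow> 'v) \<Rightarrow> ('v, 'a) tensor" where
  "tangent v u f = (if f \<in> args
     then \<Sum>t\<in>slots. entry f t (u (fst t)) * (\<Prod>r\<in>slots - {t}. entry f r (v (fst r))) else 0)"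

lemma sym_tensors_upd:
  assumes "p \<in> sym_tensors s d V I" "f \<in> args" "t \<in> slots" "g \<in> dual (fst t)"
  shows "h \<in> dual (fst t) \<Longrightarrow> p (upd f t (\<lambda>x. g x + h x)) = p (upd f t g) + p (upd f t h)"
    and "p (upd f t (\<lambda>x. c * g x)) = c * p (upd f t g)"
proof -
  have m: "multilinear s d V I p" and t: "fst t \<in> I" "snd t < d (fst t)"
    using assms unfolding sym_tensors_def slots_def by auto
  note * = m[unfolded multilinear_def, rule_format, OF assms(2) t assms(4)]
  show "p (upd f t (\<lambda>x. c * g x)) = c * p (upd f t g)"
    unfolding upd_def using *[OF assms(4)] by blast
  show "p (upd f t (\<lambda>x. g x + h x)) = p (upd f t g) + p (upd f t h)" if "h \<in> dual (fst t)"
    unfolding upd_def using *[OF that] by blast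
qed

text \<open>All other slots of the factor carry the same functional, so a transposition moves
  \<open>g\<close> to slot 0. Hence a single vector \<open>u i\<close> serves all slots of factor
  \<open>i\<close>.\<close>

lemma sym_tensors_upd_const_arg:
  assumes p: "p \<in> sym_tensors s d V I" and \<gamma>: "\<And>i. i \<in> I \<Longrightarrow> \<gamma> i \<in> dual i"
    and t: "t \<in> slots" and g: "g \<in> dual (fst t)"
  shows "p (upd (const_arg \<gamma>) t g) = p (upd (const_arg \<gamma>) (fst t, 0) g)"
proof -
  obtain i a where ia: "t = (i, a)" "i \<in> I" "a < d i" using t unfolding slots_def by auto
  let ?f = "upd (const_arg \<gamma>) (i, 0) g"
  have t0: "(i, 0) \<in> slots" using ia d_pos unfolding slots_def by auto
  have f: "?f \<in> args"
    using t0 g ia by (intro upd_in_args const_arg_in_args \<gamma>) auto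
  define \<pi> where "\<pi> j = (if j = i then transpose 0 a else id)" for j :: nat
  have "\<forall>j\<in>I. \<pi> j permutes {..<d j}"
    using ia d_pos[OF ia(2)] by (auto simp: \<pi>_def intro: permutes_swap_id permutes_id)
  then have "p (\<lambda>j\<in>I. ?f j \<circ> \<pi> j) = p ?f"
    using p f unfolding sym_tensors_def by blast
  moreover have "(\<lambda>j\<in>I. ?f j \<circ> \<pi> j) = upd (const_arg \<gamma>) t g"
  proof (rule ext, rule ext)
    fix j b
    show "(\<lambda>j\<in>I. ?f j \<circ> \<pi> j) j b = upd (const_arg \<gamma>) t g j b"
      using ia d_pos[OF ia(2)]
      by (auto simp: \<pi>_def upd_def upd_slot_def const_arg_def transpose_def restrict_def)
  qed
  ultimately show ?thesis using ia by simp
qed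

lemma sum_slots:
  fixes h :: "nat \<Rightarrow> 'a"
  shows "(\<Sum>t\<in>slots. h (fst t)) = (\<Sum>i\<in>I. of_nat (d i) * h i)"
proof -
  have "(\<Sum>i\<in>I. \<Sum>a<d i. h i) = (\<Sum>t\<in>slots. h (fst t))"
    unfolding slots_def by (subst sum.Sigma) (auto simp: case_prod_beta finite_I)
  then show ?thesis by simp
qed

text \<open>The term \<open>p(g) \<Otimes>\<^sub>i v\<^sub>i\<^sup>d\<^sup>i\<close> is spread evenly over all slots, which needs characteristic \<open>0\<close>.\<close>

lemma tangent_form_imp_tangent:
  assumes p: "p \<in> sym_tensors s d V I" and "I \<noteq> {}"
    and \<gamma>: "\<And>i. i \<in> I \<Longrightarrow> \<gamma> i \<in> dual i" "\<And>i. i \<in> I \<Longrightarrow> \<gamma> i (v i) = 1"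
    and v: "\<And>i. i \<in> I \<Longrightarrow> v i \<in> V i"
    and form: "tangent_form v (const_arg \<gamma>) p"
  obtains u where "\<And>i. i \<in> I \<Longrightarrow> u i \<in> V i" "p = tangent v u"
proof -
  let ?g = "const_arg \<gamma>"
  have g: "?g \<in> args" using \<gamma>(1) by (rule const_arg_in_args)
  define D :: 'a where "D = of_nat (card slots)"
  have "slots \<noteq> {}" using \<open>I \<noteq> {}\<close> d_pos unfolding slots_def by auto
  then have D: "D \<noteq> 0" unfolding D_def by simp
  \<comment> \<open>Each slot takes the share \<open>1 / D\<close> of the pure power and the term
    \<open>- f (v i) * p ?g\<close> of the tangent form, whence the factor \<open>1 / D - 1\<close>.
    The expression is linear in \<open>f\<close>, hence evaluation at a vector.\<close>
  have "\<exists>u\<in>V i. \<forall>f\<in>dual i. p (upd ?g (i, 0) f) + (1 / D - 1) * f (v i) * p ?g = f u"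
    if i: "i \<in> I" for i
  proof -
    have t0: "(i, 0) \<in> slots" using i d_pos unfolding slots_def by auto
    note upd = sym_tensors_upd[OF p g t0, simplified]
    obtain u where "u \<in> V i"
      "\<And>f. f \<in> dual i \<Longrightarrow> p (upd ?g (i, 0) f) + (1 / D - 1) * f (v i) * p ?g = f u"
      by (rule dual_space_reflexive[OF fin_dim[OF i],
            of "\<lambda>f. p (upd ?g (i, 0) f) + (1 / D - 1) * f (v i) * p ?g"])
        (simp_all add: upd algebra_simps)
    then show ?thesis by blast
  qed
  then obtain u where u: "\<And>i. i \<in> I \<Longrightarrow> u i \<in> V i"
    "\<And>i f. i \<in> I \<Longrightarrow> f \<in> dual i \<Longrightarrow> p (upd ?g (i, 0) f) + (1 / D - 1) * f (v i) * p ?g = f (u i)"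
    by metis
  have "p f = tangent v u f" for f
  proof (cases "f \<in> args")
    case False
    then show ?thesis using p unfolding sym_tensors_def tangent_def by simp
  next
    case True
    let ?P = "\<Prod>t\<in>slots. entry f t (v (fst t))"
    let ?R = "\<lambda>t. \<Prod>r\<in>slots - {t}. entry f r (v (fst r))"
    have "p f = ?P * p ?g + (\<Sum>t\<in>slots. ?R t * (p (upd ?g t (entry f t)) - entry f t (v (fst t)) * p ?g))"
      using form True unfolding tangent_form_def by blast
    also have "?P * p ?g = (\<Sum>t\<in>slots. ?P * p ?g / D)"
      using D by (simp add: D_def)
    also have "\<dots> + (\<Sum>t\<in>slots. ?R t * (p (upd ?g t (entry f t)) - entry f t (v (fst t)) * p ?g)) =
      (\<Sum>t\<in>slots. ?P * p ?g / D + ?R t * (p (upd ?g t (entry f t)) - entry f t (v (fst t)) * p ?g))"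
      by (simp add: sum.distrib)
    also have "\<dots> = (\<Sum>t\<in>slots. entry f t (u (fst t)) * ?R t)"
    proof (rule sum.cong)
      fix t assume t: "t \<in> slots"
      have ent: "entry f t \<in> dual (fst t)" using True t by (rule entry_in_dual)
      have upd_eq: "p (upd ?g t (entry f t)) =
          entry f t (u (fst t)) - (1 / D - 1) * entry f t (v (fst t)) * p ?g"
        using u(2)[OF slot_factor[OF t] ent] sym_tensors_upd_const_arg[OF p \<gamma>(1) t ent]
        by (simp add: algebra_simps)
      have P_eq: "?P = entry f t (v (fst t)) * ?R t" by (rule prod_slots_remove[OF t])
      show "?P * p ?g / D + ?R t * (p (upd ?g t (entry f t)) - entry f t (v (fst t)) * p ?g) =
          entry f t (u (fst t)) * ?R t"
        unfolding upd_eq P_eq by (simp add: algebra_simps)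
    qed simp
    finally show ?thesis using True by (simp add: tangent_def)
  qed
  then show ?thesis using that u(1) by blast
qed


section \<open>Dependence on a factor\<close>

lemma tangent_outside: "f \<notin> args \<Longrightarrow> tangent v u f = 0"
  unfolding tangent_def by simp

lemma ptensor_outside: "f \<notin> args \<Longrightarrow> ptensor v f = 0"
  unfolding power_tensor_def by simp

lemma tangent_upd:
  assumes "f \<in> args" "t \<in> slots" "g \<in> dual (fst t)"
  shows "tangent v u (upd f t g) =
    g (u (fst t)) * (\<Prod>r\<in>slots - {t}. entry f r (v (fst r))) +
    g (v (fst t)) * (\<Sum>r\<in>slots - {t}. entry f r (u (fst r)) *
      (\<Prod>q\<in>slots - {r} - {t}. entry f q (v (fst q))))"
proof -
  let ?F = "\<lambda>r. entry (upd f t g) r (v (fst r))"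
  have [simp]: "(\<Prod>r\<in>slots - {t}. ?F r) = (\<Prod>r\<in>slots - {t}. entry f r (v (fst r)))"
    by (intro prod.cong) (auto simp: entry_upd)
  have "(\<Sum>r\<in>slots - {t}. entry (upd f t g) r (u (fst r)) * (\<Prod>q\<in>slots - {r}. ?F q)) =
      (\<Sum>r\<in>slots - {t}. g (v (fst t)) * (entry f r (u (fst r)) *
        (\<Prod>q\<in>slots - {r} - {t}. entry f q (v (fst q)))))"
  proof (rule sum.cong)
    fix r assume r: "r \<in> slots - {t}"
    have "(\<Prod>q\<in>slots - {r}. ?F q) = ?F t * (\<Prod>q\<in>slots - {r} - {t}. ?F q)"
      using r assms(2) by (intro prod.remove) auto
    also have "(\<Prod>q\<in>slots - {r} - {t}. ?F q) = (\<Prod>q\<in>slots - {r} - {t}. entry f q (v (fst q)))"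
      by (intro prod.cong) (auto simp: entry_upd)
    finally show "entry (upd f t g) r (u (fst r)) * (\<Prod>q\<in>slots - {r}. ?F q) =
        g (v (fst t)) * (entry f r (u (fst r)) *
        (\<Prod>q\<in>slots - {r} - {t}. entry f q (v (fst q))))"
      using r by (simp add: entry_upd)
  qed simp
  then show ?thesis
    using upd_in_args[OF assms] unfolding tangent_def
    by (simp add: sum.remove[OF finite_slots assms(2)] sum_distrib_left entry_upd)
qed

lemma normalizing_functionals:
  assumes "\<And>i. i \<in> I \<Longrightarrow> v i \<in> V i" "\<And>i. i \<in> I \<Longrightarrow> v i \<noteq> 0"
  obtains \<gamma> where "\<And>i. i \<in> I \<Longrightarrow> \<gamma> i \<in> dual i" "\<And>i. i \<in> I \<Longrightarrow> \<gamma> i (v i) = 1"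
proof -
  have "\<forall>i\<in>I. \<exists>f. f \<in> dual i \<and> f (v i) = 1"
  proof
    fix i assume i: "i \<in> I"
    obtain f where "f \<in> dual i" "f (v i) = 1"
      by (rule dual_space_separates[OF fin_dim[OF i] assms[OF i]])
    then show "\<exists>f. f \<in> dual i \<and> f (v i) = 1" by blast
  qed
  then obtain \<gamma> where "\<forall>i\<in>I. \<gamma> i \<in> dual i \<and> \<gamma> i (v i) = 1"
    by (rule bchoice[THEN exE])
  then show ?thesis using that by blast
qed

text \<open>
  The witness for independence of the \<open>i\<close>-th factor is \<open>p\<close> with a fixed functional \<open>\<gamma>\<close> inserted
  in all slots of that factor.
\<close>

lemma contract_factor_sym:
  assumes p: "p \<in> sym_tensors s d V I" and i: "i \<in> I" and \<gamma>: "\<gamma> \<in> dual i"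
  shows "(\<lambda>f. if f \<in> arg_space s d V (I - {i}) then p (f(i := \<lambda>a\<in>{..<d i}. \<gamma>)) else 0)
    \<in> sym_tensors s d V (I - {i})"
proof -
  define A where "A = arg_space s d V (I - {i})"
  define ex where "ex f = f(i := \<lambda>a\<in>{..<d i}. \<gamma>)" for f :: "('v, 'a) arg"
  have ex: "ex f \<in> args" if "f \<in> A" for f
    using that i \<gamma> unfolding ex_def A_def arg_space_def
    by (auto simp: PiE_iff extensional_def)
  have upd_A: "upd_slot f j a g \<in> A" if "f \<in> A" "j \<in> I - {i}" "a < d j" "g \<in> dual j" for f j a g
    using that unfolding A_def arg_space_def upd_slot_def
    by (auto simp: PiE_iff extensional_def)
  have ex_upd: "ex (upd_slot f j a g) = upd_slot (ex f) j a g" if "j \<in> I - {i}" for f j a g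
    using that unfolding ex_def upd_slot_def by (auto simp: fun_upd_def fun_eq_iff)
  have perm_A: "(\<lambda>j\<in>I - {i}. f j \<circ> \<pi> j) \<in> A"
    if f: "f \<in> A" and \<pi>: "\<forall>j\<in>I - {i}. \<pi> j permutes {..<d j}" for f \<pi>
    unfolding A_def arg_space_def
  proof (rule restrict_PiE_iff[THEN iffD2], intro ballI)
    fix j assume j: "j \<in> I - {i}"
    have "f j \<in> {..<d j} \<rightarrow>\<^sub>E dual j" using f j unfolding A_def arg_space_def by auto
    moreover have pj: "\<pi> j permutes {..<d j}" using \<pi> j by blast
    moreover have "\<pi> j a < d j \<longleftrightarrow> a < d j" for a using permutes_in_image[OF pj, of a] by simp
    ultimately show "f j \<circ> \<pi> j \<in> {..<d j} \<rightarrow>\<^sub>E dual j"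
      by (auto simp: PiE_iff extensional_def)
  qed
  have ex_perm: "ex (\<lambda>j\<in>I - {i}. f j \<circ> \<pi> j) = (\<lambda>j\<in>I. ex f j \<circ> (\<pi>(i := id)) j)"
    if f: "f \<in> A" for f \<pi>
    using i by (auto simp: ex_def fun_eq_iff restrict_def)
  define q where "q f = (if f \<in> A then p (ex f) else 0)" for f
  have m: "multilinear s d V I p" using p unfolding sym_tensors_def by blast
  have "multilinear s d V (I - {i}) q"
    unfolding multilinear_def A_def[symmetric]
  proof (intro ballI allI impI)
    fix f j a g h c
    assume *: "f \<in> A" "j \<in> I - {i}" "a < d j" "g \<in> dual j" "h \<in> dual j"
    have "j \<in> I" using * by blast
    note m' = m[unfolded multilinear_def, rule_format, OF ex[OF *(1)] this *(3-5)]
    show "q (upd_slot f j a (\<lambda>x. g x + h x)) = q (upd_slot f j a g) + q (upd_slot f j a h) \<and>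
        q (upd_slot f j a (\<lambda>x. c * g x)) = c * q (upd_slot f j a g)"
      unfolding q_def
      using m' upd_A[OF *(1-3)] *(4,5) by (simp add: ex_upd[OF *(2)] dual_space_plus dual_space_times)
  qed
  moreover have "q (\<lambda>j\<in>I - {i}. f j \<circ> \<pi> j) = q f"
    if f: "f \<in> A" and \<pi>: "\<forall>j\<in>I - {i}. \<pi> j permutes {..<d j}" for f \<pi>
  proof -
    have "\<forall>j\<in>I. (\<pi>(i := id)) j permutes {..<d j}" using \<pi> by (auto intro: permutes_id)
    then have "p (\<lambda>j\<in>I. ex f j \<circ> (\<pi>(i := id)) j) = p (ex f)"
      using p ex[OF f] unfolding sym_tensors_def by blast
    then show ?thesis
      unfolding q_def using f perm_A[OF f \<pi>] by (simp only: ex_perm[OF f] if_True)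
  qed
  ultimately have "q \<in> sym_tensors s d V (I - {i})"
    unfolding sym_tensors_def A_def[symmetric] by (simp add: q_def)
  then show ?thesis unfolding q_def A_def ex_def .
qed

text \<open>Every functional inserted in factor \<open>i\<close> meets only multiples of
  \<open>v i\<close>, so the values at \<open>v i\<close> split off as a common factor
  \<open>?P\<close>. The cofactor is recovered by inserting \<open>\<gamma>\<close>, for which this
  common factor is 1.\<close>

lemma not_depends_if_parallel:
  assumes p: "p \<in> sym_tensors s d V I" "p = tangent v u" and i: "i \<in> I"
    and v: "v i \<in> V i" "v i \<noteq> 0" and u: "u i = s c (v i)"
  shows "\<not> depends_on_factor s d V I p i"
proof -
  obtain \<gamma> where \<gamma>: "\<gamma> \<in> dual i" "\<gamma> (v i) = 1"
    by (rule dual_space_separates[OF fin_dim[OF i] v])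
  define q where "q f = (if f \<in> arg_space s d V (I - {i}) then p (f(i := \<lambda>a\<in>{..<d i}. \<gamma>)) else 0)" for f
  have q: "q \<in> sym_tensors s d V (I - {i})"
    unfolding q_def using p(1) i \<gamma>(1) by (rule contract_factor_sym)
  define L where "L = Pair i ` {..<d i}"
  have in_L: "t \<in> L \<longleftrightarrow> fst t = i" if "t \<in> slots" for t
    using that unfolding L_def slots_def by auto
  have L_sub: "L \<subseteq> slots" using i unfolding L_def slots_def by auto
  have "p f = insert_power s d V I i (v i) q f" for f
  proof (cases "f \<in> args")
    case False
    then show ?thesis unfolding insert_power_def p(2) by (simp add: tangent_outside)
  next
    case f: True
    define f' where "f' = f(i := \<lambda>a\<in>{..<d i}. \<gamma>)"
    have f': "f' \<in> args" using f i \<gamma>(1) unfolding f'_def arg_space_def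
      by (auto simp: PiE_iff extensional_def)
    have res: "restrict f (I - {i}) \<in> arg_space s d V (I - {i})"
      using f unfolding arg_space_def by (auto simp: PiE_iff)
    have "(restrict f (I - {i}))(i := \<lambda>a\<in>{..<d i}. \<gamma>) = f'"
      using f i unfolding f'_def arg_space_def by (auto simp: fun_eq_iff PiE_iff extensional_def)
    then have qf: "q (restrict f (I - {i})) = p f'"
      unfolding q_def using res by simp
    have ent: "entry f' t = (if t \<in> L then \<gamma> else entry f t)" if "t \<in> slots" for t
      using that in_L[OF that] unfolding entry_def f'_def slots_def by auto
    let ?F = "\<lambda>t. entry f t (v (fst t))" and ?F' = "\<lambda>t. entry f' t (v (fst t))"
    let ?P = "\<Prod>t\<in>L. ?F t"
    have P: "(\<Prod>t\<in>A. ?F t) = ?P * (\<Prod>t\<in>A. ?F' t)" if "L \<subseteq> A" "A \<subseteq> slots" for A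
    proof -
      have fin: "finite A" using that(2) finite_slots by (rule finite_subset)
      have "(\<Prod>t\<in>A - L. ?F' t) = (\<Prod>t\<in>A - L. ?F t)"
        using that by (intro prod.cong) (auto simp: ent)
      moreover have "(\<Prod>t\<in>L. ?F' t) = 1"
        using \<gamma>(2) in_L L_sub by (intro prod.neutral) (auto simp: ent)
      ultimately show ?thesis
        by (simp add: prod.subset_diff[OF that(1) fin])
    qed
    have "p f = (\<Sum>t\<in>slots. entry f t (u (fst t)) * (\<Prod>r\<in>slots - {t}. ?F r))"
      using f unfolding p(2) tangent_def by simp
    also have "\<dots> = (\<Sum>t\<in>slots. ?P * (entry f' t (u (fst t)) * (\<Prod>r\<in>slots - {t}. ?F' r)))"
    proof (rule sum.cong)
      fix t assume t: "t \<in> slots"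
      show "entry f t (u (fst t)) * (\<Prod>r\<in>slots - {t}. ?F r) =
          ?P * (entry f' t (u (fst t)) * (\<Prod>r\<in>slots - {t}. ?F' r))"
      proof (cases "t \<in> L")
        case True
        have ti: "fst t = i" using in_L[OF t] True by simp
        have "entry f t (u (fst t)) = c * ?F t" "entry f' t (u (fst t)) = c * ?F' t"
          using dual_space_scale[OF entry_in_dual[OF f t]] dual_space_scale[OF entry_in_dual[OF f' t]]
            v(1) by (simp_all add: ti u)
        moreover have "?F t * (\<Prod>r\<in>slots - {t}. ?F r) = ?P * (?F' t * (\<Prod>r\<in>slots - {t}. ?F' r))"
          using P[OF L_sub order_refl] by (simp only: prod_slots_remove[OF t])
        ultimately show ?thesis by (simp add: mult.assoc mult.left_commute)
      next
        case False
        then have "(\<Prod>r\<in>slots - {t}. ?F r) = ?P * (\<Prod>r\<in>slots - {t}. ?F' r)"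
          using L_sub by (intro P) auto
        then show ?thesis using False by (simp add: ent[OF t])
      qed
    qed simp
    also have "\<dots> = ?P * p f'"
      using f' unfolding p(2) tangent_def by (simp add: sum_distrib_left)
    also have "?P = (\<Prod>a<d i. f i a (v i))"
      unfolding L_def by (subst prod.reindex) (auto simp: entry_def inj_on_def)
    finally show ?thesis
      using f unfolding insert_power_def by (simp add: qf)
  qed
  then show ?thesis
    unfolding depends_on_factor_def using q v(1) by blast
qed

text \<open>
  If \<open>p\<close> is \<open>x\<^sup>d\<^sup>i\<close> times a tensor in the other factors, inserting functionals that kill \<open>x\<close> shows
  \<open>x\<close> to be independent of \<open>v\<^sub>i\<close> and then \<open>d\<^sub>i = 1\<close>, in which case the other terms of the tangent vector
  are proportional to the power of \<open>v\<close> and merge into \<open>u\<^sub>i\<close>.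
\<close>

lemma depends_if_not_parallel:
  assumes p: "p = tangent v u" and i: "i \<in> I"
    and v: "\<And>j. j \<in> I \<Longrightarrow> v j \<in> V j" "\<And>j. j \<in> I \<Longrightarrow> v j \<noteq> 0"
    and u: "u i \<in> V i" "\<And>c. u i \<noteq> s c (v i)"
    and no_power: "\<And>x. (\<And>j. j \<in> I \<Longrightarrow> x j \<in> V j) \<Longrightarrow> (\<And>j. j \<in> I \<Longrightarrow> x j \<noteq> 0) \<Longrightarrow> p \<noteq> ptensor x"
  shows "depends_on_factor s d V I p i"
proof (rule ccontr)
  assume "\<not> ?thesis"
  then obtain x q where x: "x \<in> V i" and pq: "p = insert_power s d V I i x q"
    unfolding depends_on_factor_def by blast
  obtain \<gamma> where \<gamma>: "\<And>j. j \<in> I \<Longrightarrow> \<gamma> j \<in> dual j" "\<And>j. j \<in> I \<Longrightarrow> \<gamma> j (v j) = 1"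
    using normalizing_functionals[OF v] by metis
  let ?g = "const_arg \<gamma>"
  have g: "?g \<in> args" using \<gamma>(1) by (rule const_arg_in_args)
  have g1: "entry ?g r (v (fst r)) = 1" if "r \<in> slots" for r
    using that \<gamma>(2) slot_factor by (simp add: entry_const_arg)
  define t0 where "t0 = (i, 0 :: nat)"
  have t0: "t0 \<in> slots" "fst t0 = i" using i d_pos unfolding slots_def t0_def by auto
  have vanish: "p f = 0" if "f \<in> args" "a < d i" "f i a x = 0" for f a
    using that unfolding pq insert_power_def by auto
  have vanish0: "p (upd f t0 \<phi>) = 0" if "f \<in> args" "\<phi> \<in> dual i" "\<phi> x = 0" for f \<phi>
    using that t0 d_pos[OF i] upd_in_args[OF that(1) t0(1)]
    by (intro vanish[of _ 0]) (auto simp: upd_def upd_slot_def t0_def)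
  obtain \<psi> where \<psi>: "\<psi> \<in> dual i" "\<psi> (v i) = 0" "\<psi> (u i) = 1"
    by (rule dual_space_separates_line[OF fin_dim[OF i] v(1)[OF i] u(1) v(2)[OF i] u(2)])
  show False
  proof (cases "\<exists>c. x = s c (v i)")
    case True
    \<comment> \<open>This case includes \<open>x = 0\<close>. Inserting \<open>\<psi>\<close> gives
      0 for the insertion of a power of \<open>x\<close>, but isolates \<open>u i\<close> with value
      1 in the tangent vector.\<close>
    then have "\<psi> x = 0" using dual_space_scale[OF \<psi>(1) v(1)[OF i]] \<psi>(2) by auto
    then have "p (upd ?g t0 \<psi>) = 0" using vanish0 g \<psi>(1) by blast
    moreover have "p (upd ?g t0 \<psi>) = 1"
      unfolding p using t0 \<psi> g g1 by (simp add: tangent_upd)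
    ultimately show False by simp
  next
    case False
    then have "x \<noteq> 0" by (metis scale_zero_left)
    moreover have "v i \<noteq> s c x" for c
    proof
      assume *: "v i = s c x"
      then have "c \<noteq> 0" using v(2)[OF i] by auto
      then have "x = s (inverse c) (v i)" using * by simp
      then show False using False by blast
    qed
    ultimately obtain \<phi> where \<phi>: "\<phi> \<in> dual i" "\<phi> x = 0" "\<phi> (v i) = 1"
      using dual_space_separates_line[OF fin_dim[OF i] x v(1)[OF i]] by metis
    show False
    proof (cases "d i = 1")
      case False
      \<comment> \<open>With a second slot available, \<open>\<phi>\<close> in slot 0 kills the
        power of \<open>x\<close>, while \<open>\<psi>\<close> in slot 1 leaves only the term with
        \<open>u i\<close> there, of value 1.\<close>
      then have d2: "1 < d i" using d_pos[OF i] by simp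
      define t1 where "t1 = (i, 1 :: nat)"
      have t1: "t1 \<in> slots" "fst t1 = i" using i d2 unfolding slots_def t1_def by auto
      let ?f = "upd ?g t0 \<phi>"
      have f: "?f \<in> args" using g t0 \<phi>(1) by (auto intro: upd_in_args)
      have "upd ?f t1 \<psi> \<in> args" using f t1 \<psi>(1) by (auto intro: upd_in_args)
      then have "p (upd ?f t1 \<psi>) = 0"
        using \<phi>(2) d_pos[OF i]
        by (intro vanish[of _ 0]) (auto simp: upd_def upd_slot_def t0_def t1_def)
      moreover have "entry ?f r (v (fst r)) = 1" if "r \<in> slots" for r
        using that g1 \<phi>(3) t0 by (simp add: entry_upd)
      then have "p (upd ?f t1 \<psi>) = 1"
        unfolding p using t1 \<psi> f by (simp add: tangent_upd)
      ultimately show False by simp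
    next
      case True
      \<comment> \<open>Inserting \<open>\<phi>\<close> in the only slot of factor \<open>i\<close>
        gives 0, so the terms with the derivative in other factors amount to
        \<open>- \<phi> (u i)\<close> times the power of \<open>v\<close>. Absorbing them changes
        \<open>u i\<close> by that multiple of \<open>v i\<close>.\<close>
      define y where "y = v(i := u i + s (- \<phi> (u i)) (v i))"
      have other: "fst r \<noteq> i" if "r \<in> slots - {t0}" for r
        using that True unfolding slots_def t0_def by auto
      have "p f = ptensor y f" for f
      proof (cases "f \<in> args")
        case False
        then show ?thesis by (simp add: p tangent_outside ptensor_outside)
      next
        case f: True
        let ?R = "\<Prod>r\<in>slots - {t0}. entry f r (v (fst r))"
        let ?S = "\<Sum>r\<in>slots - {t0}. entry f r (u (fst r)) *
          (\<Prod>q\<in>slots - {r} - {t0}. entry f q (v (fst q)))"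
        have ent: "entry f t0 \<in> dual i" using entry_in_dual[OF f t0(1)] t0(2) by simp
        have "\<phi> (u i) * ?R + ?S = 0"
          using vanish0[OF f \<phi>(1,2)] unfolding p using f t0 \<phi> by (simp add: tangent_upd)
        then have S: "?S = - \<phi> (u i) * ?R" by (simp add: add_eq_0_iff)
        have "p f = p (upd f t0 (entry f t0))" by (simp add: upd_entry)
        also have "\<dots> = entry f t0 (u i) * ?R + entry f t0 (v i) * ?S"
          unfolding p using f t0 ent by (simp add: tangent_upd)
        also have "\<dots> = entry f t0 (u i + s (- \<phi> (u i)) (v i)) * ?R"
          unfolding S dual_space_add[OF ent u(1) subspace_scale[OF subspace_V[OF i] v(1)[OF i]]]
            dual_space_scale[OF ent v(1)[OF i]]
          by (simp add: algebra_simps)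
        also have "?R = (\<Prod>r\<in>slots - {t0}. entry f r (y (fst r)))"
          using other by (intro prod.cong) (auto simp: y_def)
        also have "entry f t0 (u i + s (- \<phi> (u i)) (v i)) = entry f t0 (y (fst t0))"
          by (simp add: y_def t0(2))
        also have "entry f t0 (y (fst t0)) * (\<Prod>r\<in>slots - {t0}. entry f r (y (fst r))) = ptensor y f"
          using f by (simp only: ptensor_eq prod_slots_remove[OF t0(1)])
        finally show ?thesis .
      qed
      moreover have "y j \<in> V j" if "j \<in> I" for j
        using that v(1) u(1) i
        by (auto simp: y_def intro!: subspace_diff[OF subspace_V] subspace_scale[OF subspace_V])
      moreover have "y j \<noteq> 0" if "j \<in> I" for j
      proof (cases "j = i")
        case True
        show ?thesis
        proof
          assume "y j = 0"
          then have "u i = s (\<phi> (u i)) (v i)"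
            using True by (simp add: y_def)
          then show False using u(2) by blast
        qed
      qed (use that v(2) in \<open>simp add: y_def\<close>)
      ultimately show False using no_power[of y] by blast
    qed
  qed
qed

text \<open>A multiple of \<open>v i\<close> added to \<open>u i\<close> contributes the pure power
  once for each of the \<open>d i\<close> slots. Shifts with weighted sum 0 thus leave the tangent
  vector unchanged.\<close>

lemma tangent_shift:
  assumes "\<And>i. i \<in> I \<Longrightarrow> v i \<in> V i" "\<And>i. i \<in> I \<Longrightarrow> u i \<in> V i"
  shows "tangent v (\<lambda>i. u i + s (e i) (v i)) f =
    tangent v u f + (\<Sum>i\<in>I. of_nat (d i) * e i) * ptensor v f"
proof (cases "f \<in> args")
  case False
  then show ?thesis by (simp add: tangent_outside ptensor_outside)
next
  case True
  let ?R = "\<lambda>t. \<Prod>r\<in>slots - {t}. entry f r (v (fst r))"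
  have "entry f t (u (fst t) + s (e (fst t)) (v (fst t))) * ?R t =
      entry f t (u (fst t)) * ?R t + e (fst t) * ptensor v f" if t: "t \<in> slots" for t
  proof -
    have "entry f t (u (fst t) + s (e (fst t)) (v (fst t))) =
        entry f t (u (fst t)) + e (fst t) * entry f t (v (fst t))"
      using dual_space_add[OF entry_in_dual[OF True t]] dual_space_scale[OF entry_in_dual[OF True t]]
        assms slot_factor[OF t] subspace_scale[OF subspace_V] by simp
    moreover have "ptensor v f = entry f t (v (fst t)) * ?R t"
      using True by (simp only: ptensor_eq prod_slots_remove[OF t])
    ultimately show ?thesis by (simp add: algebra_simps)
  qed
  then have "tangent v (\<lambda>i. u i + s (e i) (v i)) f =
      tangent v u f + (\<Sum>t\<in>slots. e (fst t)) * ptensor v f"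
    using True unfolding tangent_def by (simp add: sum.distrib sum_distrib_right)
  then show ?thesis by (simp add: sum_slots)
qed

section \<open>Upper and lower bound for the rank\<close>

lemma card_slots_over:
  assumes "H \<subseteq> I"
  shows "card {t \<in> slots. fst t \<in> H} = (\<Sum>i\<in>H. d i)"
proof -
  have "{t \<in> slots. fst t \<in> H} = (SIGMA i:H. {..<d i})"
    using assms unfolding slots_def by auto
  then show ?thesis using finite_subset[OF assms finite_I] by simp
qed

text \<open>
  The powers of \<open>v + x u\<close> form a rational normal curve of degree \<open>N\<close> in \<open>x\<close>, whose linear coefficient
  is the tangent vector.
\<close>

lemma tangent_as_sum_of_powers:
  assumes v: "\<And>i. i \<in> I \<Longrightarrow> v i \<in> V i" and u: "\<And>i. i \<in> I \<Longrightarrow> u i \<in> V i"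
    and H: "H \<subseteq> I" "\<And>i. i \<in> I - H \<Longrightarrow> u i = 0" and N: "(\<Sum>i\<in>H. d i) = N" "N \<ge> 2"
  shows "\<exists>(c :: nat \<Rightarrow> 'a) x. (\<forall>j<N. \<forall>i\<in>I. x j i \<in> V i) \<and>
    tangent v u = (\<lambda>f. \<Sum>j<N. c j * ptensor (x j) f)"
proof -
  let ?R = "{x::'a. x ^ N = 1}"
  have R: "finite ?R" "card ?R = N" using roots_of_unity[of N] N(2) by simp_all
  obtain z where z: "bij_betw z {..<N} ?R"
    using ex_bij_betw_nat_finite[OF R(1)] R(2) by (auto simp: atLeast0LessThan)
  define x where "x j i = v i + s (z j) (u i)" for j i
  have "tangent v u f = (\<Sum>j<N. z j ^ (N - 1) / of_nat N * ptensor (x j) f)" for f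
  proof (cases "f \<in> args")
    case False
    then show ?thesis by (simp add: tangent_outside ptensor_outside)
  next
    case f: True
    define P where "P = (\<Prod>t\<in>slots. [:entry f t (v (fst t)), entry f t (u (fst t)):])"
    have "degree P \<le> (\<Sum>t\<in>slots. degree [:entry f t (v (fst t)), entry f t (u (fst t)):])"
      unfolding P_def by (rule order_trans[OF degree_prod_sum_le]) (auto simp: o_def)
    \<comment> \<open>The vanishing of \<open>u\<close> outside \<open>H\<close> makes the linear
      factors there constant, which lowers the degree from the number of all slots to
      \<open>N\<close>.\<close>
    also have "\<dots> \<le> (\<Sum>t\<in>slots. if fst t \<in> H then 1 else 0)"
    proof (rule sum_mono)
      fix t assume t: "t \<in> slots"
      show "degree [:entry f t (v (fst t)), entry f t (u (fst t)):] \<le> (if fst t \<in> H then 1 else 0)"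
      proof (cases "fst t \<in> H")
        case False
        then have "u (fst t) = 0" using H(2) slot_factor[OF t] by blast
        moreover have "entry f t 0 = 0"
          using dual_space_scale[OF entry_in_dual[OF f t] v[OF slot_factor[OF t]], of 0] by simp
        ultimately show ?thesis using False by simp
      qed simp
    qed
    also have "\<dots> = card {t \<in> slots. fst t \<in> H}"
      by (simp add: sum.If_cases Int_def)
    also have "\<dots> = N" using card_slots_over[OF H(1)] N(1) by simp
    finally have "(\<Sum>y\<in>?R. y ^ (N - 1) / of_nat N * poly P y) = coeff P 1"
      by (rule sum_roots_of_unity_poly[OF N(2)])
    also have "coeff P 1 = tangent v u f"
      using f unfolding P_def tangent_def by (subst coeff_prod_linear) auto
    finally have "(\<Sum>y\<in>?R. y ^ (N - 1) / of_nat N * poly P y) = tangent v u f" .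
    then have *: "(\<Sum>j<N. z j ^ (N - 1) / of_nat N * poly P (z j)) = tangent v u f"
      using sum.reindex_bij_betw[OF z, of "\<lambda>y. y ^ (N - 1) / of_nat N * poly P y"] by simp
    have "poly P (z j) = ptensor (x j) f" for j
    proof -
      have "entry f t (x j (fst t)) = entry f t (v (fst t)) + z j * entry f t (u (fst t))"
        if t: "t \<in> slots" for t
        using dual_space_add[OF entry_in_dual[OF f t]] dual_space_scale[OF entry_in_dual[OF f t]]
          slot_factor[OF t] v u subspace_scale[OF subspace_V] by (simp add: x_def)
      then show ?thesis using f unfolding P_def by (simp add: poly_prod ptensor_eq)
    qed
    then show ?thesis using * by simp
  qed
  moreover have "x j i \<in> V i" if "i \<in> I" for i j
    unfolding x_def using that u v by (intro subspace_add subspace_scale subspace_V) auto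
  ultimately show ?thesis
    by (intro exI[of _ "\<lambda>j. z j ^ (N - 1) / of_nat N"] exI[of _ x]) auto
qed

text \<open>Inserting \<open>\<gamma>\<close> in all slots outside \<open>H\<close> restricts the
  tangent vector to a W-state on the remaining slots, as \<open>u\<close> vanishes outside
  \<open>H\<close>; on the right it only changes the coefficients. The remaining slots receive
  independent functionals, so the bound holds even for decompositions into arbitrary rank-one
  tensors.\<close>

lemma tangent_rank_ge:
  assumes v: "\<And>i. i \<in> I \<Longrightarrow> v i \<in> V i" "\<And>i. i \<in> I \<Longrightarrow> v i \<noteq> 0"
    and u: "\<And>i. i \<in> I \<Longrightarrow> u i \<in> V i"
    and H: "H \<subseteq> I" "\<And>i. i \<in> I - H \<Longrightarrow> u i = 0" "\<And>i c. i \<in> H \<Longrightarrow> u i \<noteq> s c (v i)"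
    and x: "\<And>j i. j < r \<Longrightarrow> i \<in> I \<Longrightarrow> x j i \<in> V i"
    and eq: "tangent v u = (\<lambda>f. \<Sum>j<r. c j * ptensor (x j) f)"
  shows "(\<Sum>i\<in>H. d i) \<le> r"
proof -
  obtain \<gamma> where \<gamma>: "\<And>i. i \<in> I \<Longrightarrow> \<gamma> i \<in> dual i" "\<And>i. i \<in> I \<Longrightarrow> \<gamma> i (v i) = 1"
    using normalizing_functionals[OF v] by metis
  define S where "S = {t \<in> slots. fst t \<in> H}"
  have S: "finite S" "S \<subseteq> slots" unfolding S_def by auto
  have "card S \<le> card {..<r}"
  proof (rule tangent_tensor_rank_ge[where D = "\<lambda>t. dual (fst t)" and v = "\<lambda>t. v (fst t)"
        and u = "\<lambda>t. u (fst t)" and x = "\<lambda>j t. x j (fst t)" and c = 0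
        and K = "\<lambda>j. c j * (\<Prod>t\<in>slots - S. \<gamma> (fst t) (x j (fst t)))"])
    show "finite S" "finite {..<r}" using S by auto
    show "\<exists>f\<in>dual (fst t). f (v (fst t)) = 1" if "t \<in> S" for t
      using that \<gamma> slot_factor S(2) by blast
    show "\<exists>f\<in>dual (fst t). f (v (fst t)) = 0 \<and> f (u (fst t)) = 1" if t: "t \<in> S" for t
    proof -
      have i: "fst t \<in> I" "fst t \<in> H" using t slot_factor unfolding S_def by auto
      obtain f where "f \<in> dual (fst t)" "f (v (fst t)) = 0" "f (u (fst t)) = 1"
        by (rule dual_space_separates_line[OF fin_dim[OF i(1)] v(1)[OF i(1)] u[OF i(1)] v(2)[OF i(1)] H(3)[OF i(2)]])
      then show ?thesis by blast
    qed
    show "(\<forall>f\<in>dual (fst t). f (v (fst t)) = 0 \<longrightarrow> f (x j (fst t)) = 0) \<or>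
        (\<exists>f\<in>dual (fst t). f (x j (fst t)) = 0 \<and> f (v (fst t)) = 1)"
      if t: "t \<in> S" and j: "j \<in> {..<r}" for t j
    proof -
      let ?i = "fst t"
      have i: "?i \<in> I" using t slot_factor unfolding S_def by auto
      have xj: "x j ?i \<in> V ?i" using x i j by auto
      show ?thesis
      proof (cases "\<exists>c. x j ?i = s c (v ?i)")
        case True
        then show ?thesis using dual_space_scale v(1)[OF i] by fastforce
      next
        case False
        then have "x j ?i \<noteq> 0" by (metis scale_zero_left)
        moreover have "v ?i \<noteq> s c (x j ?i)" for c
        proof
          assume *: "v ?i = s c (x j ?i)"
          then have "c \<noteq> 0" using v(2)[OF i] by auto
          then have "x j ?i = s (inverse c) (v ?i)" using * by simp
          then show False using False by blast
        qed
        ultimately obtain f where "f \<in> dual ?i" "f (x j ?i) = 0" "f (v ?i) = 1"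
          using dual_space_separates_line[OF fin_dim[OF i] xj v(1)[OF i]] by metis
        then show ?thesis by blast
      qed
    qed
    fix f assume f: "\<And>t. t \<in> S \<Longrightarrow> f t \<in> dual (fst t)"
    define g :: "('v, 'a) arg" where
      "g = (\<lambda>i\<in>I. \<lambda>a\<in>{..<d i}. if (i, a) \<in> S then f (i, a) else \<gamma> i)"
    have g: "g \<in> args"
      unfolding arg_space_def g_def using \<gamma>(1) f by force
    have ent: "entry g t = (if t \<in> S then f t else \<gamma> (fst t))" if "t \<in> slots" for t
      using that unfolding entry_def g_def slots_def by auto
    have split: "(\<Prod>t\<in>A. entry g t (y t)) = (\<Prod>t\<in>A - S. \<gamma> (fst t) (y t)) * (\<Prod>t\<in>A \<inter> S. f t (y t))"
      if "A \<subseteq> slots" for A y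
    proof -
      have "finite A" using that finite_slots by (rule finite_subset)
      then have "(\<Prod>t\<in>A. entry g t (y t)) = (\<Prod>t\<in>A - S. entry g t (y t)) * (\<Prod>t\<in>A \<inter> S. entry g t (y t))"
        by (subst prod.union_disjoint[symmetric]) (auto intro!: prod.cong)
      also have "(\<Prod>t\<in>A - S. entry g t (y t)) = (\<Prod>t\<in>A - S. \<gamma> (fst t) (y t))"
        using that by (intro prod.cong) (auto simp: ent)
      also have "(\<Prod>t\<in>A \<inter> S. entry g t (y t)) = (\<Prod>t\<in>A \<inter> S. f t (y t))"
        using that by (intro prod.cong) (auto simp: ent)
      finally show ?thesis .
    qed
    have \<gamma>1: "(\<Prod>t\<in>A - S. \<gamma> (fst t) (v (fst t))) = 1" if "A \<subseteq> slots" for A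
      using that \<gamma>(2) slot_factor by (intro prod.neutral) blast
    have "tangent v u g = (\<Sum>t\<in>slots. entry g t (u (fst t)) * (\<Prod>r\<in>slots - {t}. entry g r (v (fst r))))"
      using g unfolding tangent_def by simp
    also have "\<dots> = (\<Sum>t\<in>S. f t (u (fst t)) * (\<Prod>r\<in>S - {t}. f r (v (fst r))))"
    proof (rule sum.mono_neutral_cong_right)
      show "\<forall>t\<in>slots - S. entry g t (u (fst t)) * (\<Prod>r\<in>slots - {t}. entry g r (v (fst r))) = 0"
      proof
        fix t assume t: "t \<in> slots - S"
        then have i: "fst t \<in> I - H" "fst t \<in> I" using slot_factor unfolding S_def by auto
        then have "\<gamma> (fst t) (u (fst t)) = 0"
          using H(2) dual_space_scale[OF \<gamma>(1)[OF i(2)] v(1)[OF i(2)], of 0] by simp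
        then show "entry g t (u (fst t)) * (\<Prod>r\<in>slots - {t}. entry g r (v (fst r))) = 0"
          using t by (simp add: ent)
      qed
      fix t assume t: "t \<in> S"
      then have "(slots - {t}) \<inter> S = S - {t}" using S by auto
      then show "entry g t (u (fst t)) * (\<Prod>r\<in>slots - {t}. entry g r (v (fst r))) =
          f t (u (fst t)) * (\<Prod>r\<in>S - {t}. f r (v (fst r)))"
        using t S(2) \<gamma>1[of "slots - {t}"] by (subst split) (auto simp: ent)
    qed (use S in auto)
    finally have lhs: "tangent v u g = (\<Sum>t\<in>S. f t (u (fst t)) * (\<Prod>r\<in>S - {t}. f r (v (fst r))))" .
    have "slots \<inter> S = S" using S by auto
    then have "ptensor (x j) g = (\<Prod>t\<in>slots - S. \<gamma> (fst t) (x j (fst t))) * (\<Prod>t\<in>S. f t (x j (fst t)))" for j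
      using g by (simp add: ptensor_eq split)
    then show "(\<Sum>t\<in>S. f t (u (fst t)) * (\<Prod>r\<in>S - {t}. f r (v (fst r)))) +
        0 * (\<Prod>t\<in>S. f t (v (fst t))) =
      (\<Sum>j\<in>{..<r}. c j * (\<Prod>t\<in>slots - S. \<gamma> (fst t) (x j (fst t))) * (\<Prod>t\<in>S. f t (x j (fst t))))"
      using lhs fun_cong[OF eq, of g] by (simp add: mult.assoc)
  qed
  then show ?thesis
    unfolding S_def using card_slots_over[OF H(1)] by simp
qed

lemma proj_class_in_segre_veronese:
  assumes "p = (\<lambda>f. c * ptensor x f)" "c \<noteq> 0" "\<And>i. i \<in> I \<Longrightarrow> x i \<in> V i" "\<And>i. i \<in> I \<Longrightarrow> x i \<noteq> 0"
  shows "proj_class p \<in> segre_veronese s d V I"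
proof -
  have "proj_class p = proj_class (ptensor x)"
  proof
    show "proj_class p \<subseteq> proj_class (ptensor x)"
    proof
      fix y assume "y \<in> proj_class p"
      then obtain b where "b \<noteq> 0" "y = (\<lambda>f. b * p f)" unfolding proj_class_def by blast
      then have "y = (\<lambda>f. (b * c) * ptensor x f)" "b * c \<noteq> 0" using assms by auto
      then show "y \<in> proj_class (ptensor x)" unfolding proj_class_def by blast
    qed
    show "proj_class (ptensor x) \<subseteq> proj_class p"
    proof
      fix y assume "y \<in> proj_class (ptensor x)"
      then obtain b where "b \<noteq> 0" "y = (\<lambda>f. b * ptensor x f)" unfolding proj_class_def by blast
      then have "y = (\<lambda>f. (b / c) * p f)" "b / c \<noteq> 0" using assms by auto
      then show "y \<in> proj_class p" unfolding proj_class_def by blast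
    qed
  qed
  then show ?thesis unfolding segre_veronese_def using assms(3,4) by blast
qed

theorem rank_of_tangential:
  assumes I: "I \<noteq> {}" and p: "p \<in> sym_tensors s d V I" "p \<noteq> (\<lambda>_. 0)"
    and tangential: "proj_class p \<in> tangential_variety W (segre_veronese s d V I)"
    and not_X: "proj_class p \<notin> segre_veronese s d V I"
  shows "sv_rank s d V I p = (\<Sum>i | i \<in> I \<and> depends_on_factor s d V I p i. d i)"
proof -
  obtain v \<gamma> where v\<gamma>: "\<And>i. i \<in> I \<Longrightarrow> v i \<in> V i" "\<And>i. i \<in> I \<Longrightarrow> \<gamma> i \<in> dual i"
    "\<And>i. i \<in> I \<Longrightarrow> \<gamma> i (v i) = 1" "tangent_form v (const_arg \<gamma>) p"
    using tangent_form_limit[of p] tangential_variety_eval_zero[OF tangential] by metis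
  note v = v\<gamma>(1)
  have v0: "v i \<noteq> 0" if "i \<in> I" for i
    using v\<gamma>(3)[OF that] dual_space_scale[OF v\<gamma>(2)[OF that] v[OF that], of 0] by auto
  obtain u where u: "\<And>i. i \<in> I \<Longrightarrow> u i \<in> V i" and pu: "p = tangent v u"
    using tangent_form_imp_tangent[OF p(1) I v\<gamma>(2,3) v v\<gamma>(4)] by metis
  have no_power: "p \<noteq> (\<lambda>f. c * ptensor x f)"
    if "\<And>i. i \<in> I \<Longrightarrow> x i \<in> V i" "\<And>i. i \<in> I \<Longrightarrow> x i \<noteq> 0" for c x
    using proj_class_in_segre_veronese[of p c x] that p(2) not_X by (cases "c = 0") auto
  define H where "H = {i \<in> I. \<forall>c. u i \<noteq> s c (v i)}"
  have H: "H \<subseteq> I" unfolding H_def by blast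
  have "depends_on_factor s d V I p i \<longleftrightarrow> i \<in> H" if i: "i \<in> I" for i
  proof (cases "i \<in> H")
    case True
    have "depends_on_factor s d V I p i"
    proof (rule depends_if_not_parallel[OF pu i v v0 u[OF i]])
      show "u i \<noteq> s c (v i)" for c using True unfolding H_def by blast
      show "p \<noteq> ptensor x" if "\<And>j. j \<in> I \<Longrightarrow> x j \<in> V j" "\<And>j. j \<in> I \<Longrightarrow> x j \<noteq> 0" for x
        using no_power[OF that, of 1] by simp
    qed
    then show ?thesis using True by simp
  next
    case False
    then obtain c where "u i = s c (v i)" using i unfolding H_def by blast
    then show ?thesis
      using not_depends_if_parallel[OF p(1) pu i v[OF i] v0[OF i]] False by blast
  qed
  then have dep: "{i. i \<in> I \<and> depends_on_factor s d V I p i} = H" using H by blast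
  have "\<forall>i\<in>I. \<exists>c. i \<notin> H \<longrightarrow> u i = s c (v i)" unfolding H_def by blast
  then obtain b where b: "\<forall>i\<in>I. i \<notin> H \<longrightarrow> u i = s (b i) (v i)"
    by (rule bchoice[THEN exE])

  have tangent_0: "tangent v (\<lambda>i. 0) f = 0" for f
  proof (cases "f \<in> args")
    case True
    have "entry f t 0 = 0" if "t \<in> slots" for t
      using dual_space_scale[OF entry_in_dual[OF True that] v[OF slot_factor[OF that]], of 0] by simp
    then show ?thesis unfolding tangent_def by simp
  qed (simp add: tangent_outside)
  \<comment> \<open>If every \<open>u i\<close> were parallel to \<open>v i\<close>, then
    \<open>p\<close> would be a multiple of the power of \<open>v\<close>.\<close>
  have "H \<noteq> {}"
  proof
    assume "H = {}"
    have "tangent v u f = tangent v (\<lambda>i. 0 + s (b i) (v i)) f" for f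
      using b \<open>H = {}\<close> slot_factor unfolding tangent_def by (simp cong: sum.cong)
    then have "p f = (\<Sum>i\<in>I. of_nat (d i) * b i) * ptensor v f" for f
      unfolding pu
      using tangent_shift[of v "\<lambda>i. 0" b f] v subspace_0[OF subspace_V] tangent_0 by simp
    then show False using no_power[OF v v0] by blast
  qed
  then obtain i0 where i0: "i0 \<in> H" by blast
  then have i0I: "i0 \<in> I" using H by blast
  define C where "C = (\<Sum>i\<in>I - H. of_nat (d i) * b i)"
  \<comment> \<open>Moving a multiple of \<open>v\<close> from the parallel factors to the factor \<open>i0\<close> makes \<open>u\<close> vanish outside \<open>H\<close>.\<close>
  define e where "e i = (if i = i0 then C / of_nat (d i0) else if i \<in> H then 0 else - b i)" for i
  define w where "w i = u i + s (e i) (v i)" for i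
  have "(\<Sum>i\<in>I. of_nat (d i) * e i) = (\<Sum>i\<in>H. of_nat (d i) * e i) + (\<Sum>i\<in>I - H. of_nat (d i) * e i)"
    using H finite_I by (simp add: sum.subset_diff add.commute)
  also have "(\<Sum>i\<in>H. of_nat (d i) * e i) = (\<Sum>i\<in>H. if i = i0 then C else 0)"
    using d_pos[OF i0I] by (intro sum.cong) (auto simp: e_def)
  also have "\<dots> = C" using i0 finite_subset[OF H finite_I] by simp
  also have "(\<Sum>i\<in>I - H. of_nat (d i) * e i) = - C"
    using i0 unfolding C_def by (auto simp: e_def sum_negf[symmetric] intro!: sum.cong)
  finally have "(\<Sum>i\<in>I. of_nat (d i) * e i) = 0" by simp
  then have pw: "p = tangent v w"
    unfolding pu w_def using tangent_shift[OF v u, where e = e] by auto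
  have w: "w i \<in> V i" if "i \<in> I" for i
    unfolding w_def using that u v by (intro subspace_add subspace_scale subspace_V) auto
  have w0: "w i = 0" if "i \<in> I - H" for i
    using that b i0 by (auto simp: w_def e_def)
  have w_indep: "w i \<noteq> s c (v i)" if "i \<in> H" for i c
  proof
    assume "w i = s c (v i)"
    then have "u i = s (c - e i) (v i)" by (simp add: w_def scale_left_diff_distrib eq_diff_eq)
    then show False using that unfolding H_def by blast
  qed
  define N where "N = (\<Sum>i\<in>H. d i)"
  \<comment> \<open>With a single slot over \<open>H\<close> the tangent vector has one term: the
    power tensor with \<open>v i0\<close> replaced by \<open>w i0\<close>, a point of X.\<close>
  have "N \<ge> 2"
  proof (rule ccontr)
    assume "\<not> ?thesis"
    then have "card {t \<in> slots. fst t \<in> H} < 2" using card_slots_over[OF H] by (simp add: N_def)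
    moreover have t0: "(i0, 0) \<in> {t \<in> slots. fst t \<in> H}"
      using i0 i0I d_pos[OF i0I] unfolding slots_def by auto
    moreover have "finite {t \<in> slots. fst t \<in> H}" by simp
    ultimately have "card {t \<in> slots. fst t \<in> H} = 1"
      by (metis (no_types, lifting) One_nat_def card_gt_0_iff empty_iff less_2_cases nat_less_le)
    then have only: "{t \<in> slots. fst t \<in> H} = {(i0, 0)}"
      using t0 by (metis (no_types, lifting) card_1_singletonE singletonD)
    define y where "y = v(i0 := w i0)"
    have t0s: "(i0, 0) \<in> slots" using t0 by blast
    have other: "fst t \<noteq> i0" "w (fst t) = 0" if "t \<in> slots - {(i0, 0)}" for t
    proof -
      have "fst t \<notin> H" using only that by blast
      then show "fst t \<noteq> i0" "w (fst t) = 0" using i0 w0 slot_factor that by auto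
    qed
    have "p f = 1 * ptensor y f" for f
    proof (cases "f \<in> args")
      case False
      then show ?thesis by (simp add: pw tangent_outside ptensor_outside)
    next
      case f: True
      have ent0: "entry f t 0 = 0" if "t \<in> slots" for t
        using dual_space_scale[OF entry_in_dual[OF f that] v[OF slot_factor[OF that]], of 0] by simp
      have "p f = entry f (i0, 0) (w i0) * (\<Prod>r\<in>slots - {(i0, 0)}. entry f r (v (fst r)))"
        using f other ent0 unfolding pw tangent_def
        by (simp add: sum.remove[OF finite_slots t0s])
      also have "(\<Prod>r\<in>slots - {(i0, 0)}. entry f r (v (fst r))) =
          (\<Prod>r\<in>slots - {(i0, 0)}. entry f r (y (fst r)))"
        using other by (intro prod.cong) (auto simp: y_def)
      also have "entry f (i0, 0) (w i0) * \<dots> = ptensor y f"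
        using f by (simp add: ptensor_eq prod_slots_remove[OF t0s] y_def)
      finally show ?thesis by simp
    qed
    moreover have "y i \<in> V i" if "i \<in> I" for i using that v w by (auto simp: y_def)
    moreover have "y i \<noteq> 0" if "i \<in> I" for i
      using that v0 w_indep[OF i0, of 0] by (auto simp: y_def)
    ultimately show False using no_power[of y 1] by blast
  qed
  have "sv_rank s d V I p = N"
    unfolding sv_rank_def
  proof (rule Least_equality)
    show "\<exists>(c :: nat \<Rightarrow> 'a) x. (\<forall>j<N. \<forall>i\<in>I. x j i \<in> V i) \<and> p = (\<lambda>f. \<Sum>j<N. c j * ptensor (x j) f)"
      unfolding pw using tangent_as_sum_of_powers[OF v w H w0 N_def[symmetric] \<open>N \<ge> 2\<close>] .
    fix r
    assume "\<exists>(c :: nat \<Rightarrow> 'a) x. (\<forall>j<r. \<forall>i\<in>I. x j i \<in> V i) \<and> p = (\<lambda>f. \<Sum>j<r. c j * ptensor (x j) f)"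
    then obtain c :: "nat \<Rightarrow> 'a" and x where "\<forall>j<r. \<forall>i\<in>I. x j i \<in> V i"
      "p = (\<lambda>f. \<Sum>j<r. c j * ptensor (x j) f)" by blast
    then show "N \<le> r"
      unfolding N_def pw using tangent_rank_ge[OF v v0 w H w0 w_indep, of r x c] by blast
  qed
  then show ?thesis by (simp add: dep N_def)
qed

end

theorem theorem2p1:
  fixes s :: "'a::{alg_closed_field, field_char_0} \<Rightarrow> 'v::ab_group_add \<Rightarrow> 'v"
    and k h :: nat and V :: "nat \<Rightarrow> 'v set" and d \<sigma> :: "nat \<Rightarrow> nat"
    and p :: "('v, 'a) tensor"
  defines "W \<equiv> sym_tensors s d V {1..k}"
    and "X \<equiv> segre_veronese s d V {1..k}"
  assumes "vector_space s"
    and "k \<ge> 1"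
    and "\<forall>i\<in>{1..k}. fin_dim_subspace s (V i)"
    and "\<forall>i\<in>{1..k}. d i > 0"
    and "p \<in> W" and "p \<noteq> (\<lambda>_. 0)"
    and "proj_class p \<in> tangential_variety W X - X"
    and "h \<le> k" and "\<sigma> permutes {1..k}"
    and "\<forall>i\<in>{1..k}. depends_on_factor s d V {1..k} p (\<sigma> i) \<longleftrightarrow> i \<le> h"
  shows "sv_rank s d V {1..k} p = (\<Sum>i=1..h. d (\<sigma> i))"
proof -
  interpret vector_space s by fact
  interpret sv_space s d V "{1..k}"
    by unfold_locales (use assms in auto)
  have "sv_rank s d V {1..k} p =
      (\<Sum>i | i \<in> {1..k} \<and> depends_on_factor s d V {1..k} p i. d i)"
    using assms by (intro rank_of_tangential[where W = W]) auto
  also have "{i. i \<in> {1..k} \<and> depends_on_factor s d V {1..k} p i} = \<sigma> ` {1..h}"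
  proof (intro equalityI subsetI)
    fix j assume j: "j \<in> {i. i \<in> {1..k} \<and> depends_on_factor s d V {1..k} p i}"
    then obtain i where "i \<in> {1..k}" "j = \<sigma> i"
      using permutes_image[OF assms(11)] by blast
    then show "j \<in> \<sigma> ` {1..h}" using j assms(12) by auto
  next
    fix j assume "j \<in> \<sigma> ` {1..h}"
    then obtain i where "i \<in> {1..h}" "j = \<sigma> i" by blast
    moreover from this have "i \<in> {1..k}" using \<open>h \<le> k\<close> by simp
    ultimately show "j \<in> {i. i \<in> {1..k} \<and> depends_on_factor s d V {1..k} p i}"
      using assms(12) permutes_in_image[OF assms(11), of i] by auto
  qed
  also have "(\<Sum>i\<in>\<sigma> ` {1..h}. d i) = (\<Sum>i=1..h. d (\<sigma> i))"
    using permutes_inj_on[OF assms(11)] by (subst sum.reindex) auto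
  finally show ?thesis .
qed

end
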